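(* (1) Let $1\le\ell_1\le\dots\le\ell_r\le n$ and $T=C_r\otimes\cdots\otimes C_1$ with $C_i\in B(\varpi_{\ell_i})$. Then $\widetilde\psi_T=\prod_{i=1}^{r-1}\widetilde\psi_{C_{i+1}\otimes C_i}$. (2) Let $1\le a\le b\le n$, $F\in B(\varpi_b)$, $E\in B(\varpi_a)$. Then: (a) if $F\otimes E$ is not semistandard, $\widetilde\psi_{F\otimes E}=0$; (b) if $E=(1,\dots,a)$ and $F\otimes E$ is semistandard, $\widetilde\psi_{F\otimes E}=1$; (c) if $F\otimes E$ is semistandard and $j\in[n-1]$ with $s_jE\le E$, then $$\widetilde\psi_{F\otimes E}=\begin{cases}t\,\widetilde\psi_{s_jF\otimes s_jE}+(1-t)\,\widetilde\psi_{F\otimes s_jE}, & \text{if } s_jF\ge F,\\ \widetilde\psi_{s_jF\otimes s_jE}, & \text{if } s_jF\le F.\end{cases}$$ In particular every $\widetilde\psi_T$ lies in $\mathbb Z[t]$.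
   Context: Fix $n\ge1$, $[n]=\{1,\dots,n\}$. $S_n$ is the symmetric group with simple transpositions $s_i=(i,i+1)$ and length function $\ell(\cdot)$; it acts on $\mathbb Z^n$ by permuting coordinates; $\varpi_k=\varepsilon_1+\dots+\varepsilon_k$ ($\varepsilon_i$ standard basis). For $\lambda\in\mathbb Z^n$, $S_{n,\lambda}=\{w:w\lambda=\lambda\}$ and $W_\lambda(t)=\sum_{w\in S_{n,\lambda}}t^{\ell(w)}$. The affine Hecke algebra $H$ is the $\mathbb Z[t^{\pm1}]$-algebra with generators $T_1,\dots,T_{n-1},X_1^{\pm1},\dots,X_n^{\pm1}$ and relations $T_i^2=(t-1)T_i+t$, $T_iT_{i+1}T_i=T_{i+1}T_iT_{i+1}$, $T_iT_j=T_jT_i$ ($|i-j|>1$), $X_iX_j=X_jX_i$, $T_iX_iT_i=tX_{i+1}$, $T_iX_j=X_jT_i$ ($j\notin\{i,i+1\}$). $T_w=T_{i_1}\cdots T_{i_m}$ for a reduced word of $w$. $H_n$ is the subalgebra generated by the $T_i$ (basis $\{T_w\}$); $H_{n,\lambda}$ is the span of $\{T_w:w\in S_{n,\lambda}\}$; $\mathbf 1_\lambda=\sum_{w\in S_{n,\lambda}}T_w$. Columns: a column of length $\ell$ is $C=(c_1<\dots<c_\ell)\subseteq[n]$; $B(\varpi_\ell)$ is their set; partial order $E\le F$ iff $e_i\le f_i$ for all $i$. $u_C\in S_n$ sends $k\mapsto c_k$ ($k\le\ell$) and sends $\ell+1,\dots,n$ increasingly onto $[n]\setminus C$. $s_jC$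 is the column whose underlying set is the image of $C$ under the transposition $(j,j+1)$. Tensors $T=C_r\otimes\cdots\otimes C_1$ ($C_i\in B(\varpi_{\ell_i})$, $\ell_1\le\dots\le\ell_r$) are fillings of the Young diagram of $\lambda=\sum\varpi_{\ell_i}$ with columns $C_r,\dots,C_1$ left to right; semistandard means rows weakly increase left to right. Definition of $\Psi$: every $h\in H_n$ is uniquely $\sum_{F\in B(\varpi_\ell)}T_{u_F}h_F$ with $h_F\in H_{n,\varpi_\ell}$. For a column $C\in B(\varpi_\ell)$, $\Psi_C=t^{\ell(u_C)}(T_{u_C^{-1}})^{-1}\mathbf 1_{\varpi_\ell}$; for $T=C\otimes S$, $C\in B(\varpi_\ell)$, $S$ a tensor of columns of lengths $\le\ell$, write $\Psi_S=\sum_{E\in B(\varpi_\ell)}T_{u_E}h_{E,S}$ ($h_{E,S}\in H_{n,\varpi_\ell}$) and set $\Psi_T=t^{\ell(u_C)}(T_{u_C^{-1}})^{-1}h_{C,S}$. Definition of $\widetilde\psi$: for $T$ of shape $\lambda$ with $\Psi_T=\sum_{w\in S_n}a_wT_w$ ($a_w\in\mathbb Z[t^{\pm1}]$), $\widetilde\psi_T=W_\lambda(t)^{-1}\sum_w a_wt^{\ell(w)}\in\mathbb Q(t)$; equivalently $\widetilde\psi_T\mathbf 1_0=W_\lambda(t)^{-1}\Psi_T\mathbf 1_0$ where $\mathbf 1_0=\sum_{w\in S_n}T_w$. *)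

theory Defs
  imports "HOL-Computational_Algebra.Polynomial" "HOL-Computational_Algebra.Fraction_Field"
    "HOL-Combinatorics.Permutations"
begin

text \<open>Coefficients: the field Q(t), realised as the fraction field of Z[t].
  Elements of the finite Hecke algebra H_n are coefficient functions on permutations
  of nat supported on S_n (permutations of {1..n}), h = sum_w h(w) T_w.\<close>

type_synonym coef = "int poly fract"
type_synonym hecke = "(nat \<Rightarrow> nat) \<Rightarrow> coef"

definition tt :: coef where "tt = Fract [:0, 1:] 1"

definition Sn :: "nat \<Rightarrow> (nat \<Rightarrow> nat) set" where
  "Sn n = {w. w permutes {1..n}}"

definition len :: "nat \<Rightarrow> (nat \<Rightarrow> nat) \<Rightarrow> nat" where
  "len n w = card {(i, j). 1 \<le> i \<and> i < j \<and> j \<le> n \<and> w j < w i}"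

definition sw :: "nat \<Rightarrow> nat \<Rightarrow> nat" where
  "sw j = (\<lambda>k. if k = j then Suc j else if k = Suc j then j else k)"

definition Hn :: "nat \<Rightarrow> hecke set" where
  "Hn n = {h. \<forall>w. h w \<noteq> 0 \<longrightarrow> w \<in> Sn n}"

definition Tb :: "(nat \<Rightarrow> nat) \<Rightarrow> hecke" where
  "Tb w = (\<lambda>v. if v = w then 1 else 0)"

definition hone :: hecke where "hone = Tb id"

definition hsmult :: "coef \<Rightarrow> hecke \<Rightarrow> hecke" where
  "hsmult c h = (\<lambda>v. c * h v)"

text \<open>right multiplication by T_i, using T_w T_i = T_{w s_i} if l(w s_i) > l(w),
  and T_w T_i = (t-1) T_w + t T_{w s_i} otherwise\<close>
definition rmul :: "nat \<Rightarrow> nat \<Rightarrow> hecke \<Rightarrow> hecke" where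
  "rmul n i h = (\<lambda>v. if v \<notin> Sn n then 0
     else if len n (v \<circ> sw i) < len n v then (tt - 1) * h v + h (v \<circ> sw i)
     else tt * h (v \<circ> sw i))"

definition redword :: "nat \<Rightarrow> (nat \<Rightarrow> nat) \<Rightarrow> nat list" where
  "redword n w = (SOME is. set is \<subseteq> {1..<n} \<and> length is = len n w \<and>
       w = foldr (\<lambda>i f. sw i \<circ> f) is id)"

definition rmulT :: "nat \<Rightarrow> (nat \<Rightarrow> nat) \<Rightarrow> hecke \<Rightarrow> hecke" where
  "rmulT n w h = fold (rmul n) (redword n w) h"

definition hmul :: "nat \<Rightarrow> hecke \<Rightarrow> hecke \<Rightarrow> hecke" where
  "hmul n h g = (\<lambda>v. \<Sum>w\<in>Sn n. g w * rmulT n w h v)"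

definition hinv :: "nat \<Rightarrow> hecke \<Rightarrow> hecke" where
  "hinv n x = (THE y. y \<in> Hn n \<and> hmul n x y = hone \<and> hmul n y x = hone)"

text \<open>weights lambda in Z^n as functions on indices 1..n\<close>
definition varpi :: "nat \<Rightarrow> nat \<Rightarrow> int" where
  "varpi l = (\<lambda>k. if 1 \<le> k \<and> k \<le> l then 1 else 0)"

definition stab :: "nat \<Rightarrow> (nat \<Rightarrow> int) \<Rightarrow> (nat \<Rightarrow> nat) set" where
  "stab n lam = {w \<in> Sn n. \<forall>k\<in>{1..n}. lam (w k) = lam k}"

definition one_par :: "nat \<Rightarrow> (nat \<Rightarrow> int) \<Rightarrow> hecke" where
  "one_par n lam = (\<lambda>v. if v \<in> stab n lam then 1 else 0)"

definition Hpar :: "nat \<Rightarrow> (nat \<Rightarrow> int) \<Rightarrow> hecke set" where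
  "Hpar n lam = {h \<in> Hn n. \<forall>w. h w \<noteq> 0 \<longrightarrow> w \<in> stab n lam}"

definition Wpoly :: "nat \<Rightarrow> (nat \<Rightarrow> int) \<Rightarrow> coef" where
  "Wpoly n lam = (\<Sum>w\<in>stab n lam. tt ^ len n w)"

text \<open>Columns are subsets of {1..n}; entry C k is the k-th smallest element (1-indexed).\<close>
definition cols :: "nat \<Rightarrow> nat \<Rightarrow> nat set set" where
  "cols n l = {C. C \<subseteq> {1..n} \<and> card C = l}"

definition entry :: "nat set \<Rightarrow> nat \<Rightarrow> nat" where
  "entry C k = sorted_list_of_set C ! (k - 1)"

definition col_le :: "nat set \<Rightarrow> nat set \<Rightarrow> bool" where
  "col_le E F = (card E = card F \<and> (\<forall>i\<in>{1..card E}. entry E i \<le> entry F i))"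

definition ucol :: "nat \<Rightarrow> nat set \<Rightarrow> nat \<Rightarrow> nat" where
  "ucol n C = (\<lambda>k. if 1 \<le> k \<and> k \<le> card C then entry C k
      else if card C < k \<and> k \<le> n then sorted_list_of_set ({1..n} - C) ! (k - card C - 1)
      else k)"

definition scol :: "nat \<Rightarrow> nat set \<Rightarrow> nat set" where
  "scol j C = sw j ` C"

definition decomp :: "nat \<Rightarrow> nat \<Rightarrow> hecke \<Rightarrow> nat set \<Rightarrow> hecke" where
  "decomp n l h = (THE f. (\<forall>F. F \<notin> cols n l \<longrightarrow> f F = (\<lambda>_. 0)) \<and>
       (\<forall>F\<in>cols n l. f F \<in> Hpar n (varpi l)) \<and>
       h = (\<lambda>v. \<Sum>F\<in>cols n l. hmul n (Tb (ucol n F)) (f F) v))"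

text \<open>Tensors C_r (x) ... (x) C_1 are lists [C_r, ..., C_1] (left to right).\<close>
fun Psi :: "nat \<Rightarrow> nat set list \<Rightarrow> hecke" where
  "Psi n [] = hone"
| "Psi n [C] = hmul n (hsmult (tt ^ len n (ucol n C)) (hinv n (Tb (inv (ucol n C)))))
                 (one_par n (varpi (card C)))"
| "Psi n (C # D # S) = hmul n (hsmult (tt ^ len n (ucol n C)) (hinv n (Tb (inv (ucol n C)))))
                 (decomp n (card C) (Psi n (D # S)) C)"

definition shape :: "nat set list \<Rightarrow> nat \<Rightarrow> int" where
  "shape Ts = (\<lambda>k. \<Sum>C\<leftarrow>Ts. varpi (card C) k)"

definition psit :: "nat \<Rightarrow> nat set list \<Rightarrow> coef" where
  "psit n Ts = inverse (Wpoly n (shape Ts)) * (\<Sum>w\<in>Sn n. Psi n Ts w * tt ^ len n w)"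

definition tensor :: "nat \<Rightarrow> nat set list \<Rightarrow> bool" where
  "tensor n Ts = (Ts \<noteq> [] \<and> (\<forall>C\<in>set Ts. C \<subseteq> {1..n} \<and> 1 \<le> card C) \<and>
                  sorted_wrt (\<lambda>C D. card D \<le> card C) Ts)"

text \<open>F (x) E (F left, length b >= a = length E) is semistandard: rows weakly increase\<close>
definition semistd2 :: "nat set \<Rightarrow> nat set \<Rightarrow> bool" where
  "semistd2 F E = (\<forall>i\<in>{1..card E}. entry F i \<le> entry E i)"

end

theory Submission
  imports Defs
begin

text \<open>
  Left multiplication by \<open>t\<^bsup>l(u)\<^esup> (T\<^bsub>u\<^sup>-\<^sup>1\<^esub>)\<^sup>-\<^sup>1\<close> is the product of the operators
  \<open>t T\<^sub>i\<^sup>-\<^sup>1 = T\<^sub>i + 1 - t\<close> along a reduced word of \<open>u\<close>, and it preserves the trivial character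
  \<open>T\<^sub>w \<mapsto> t\<^bsup>l(w)\<^esup>\<close>. Hence the character of \<open>\<Psi>\<close> of \<open>C \<otimes> S\<close> is that of the \<open>C\<close>-component of
  \<open>\<Psi>\<^sub>S\<close>, and these numbers, as functions of \<open>C\<close>, form the module induced from the trivial character,
  on which \<open>t T\<^sub>j\<^sup>-\<^sup>1\<close> acts by the recursion of part (2)(c). If \<open>D\<close> is the first column of \<open>S\<close>,
  with \<open>a\<close> entries, then \<open>\<Psi>\<^sub>S\<close> arises by applying the operator of \<open>u\<^sub>D\<close> to some \<open>h\<close> supported on
  \<open>S\<^sub>a \<times> S\<^bsub>n-a\<^esub>\<close> and right invariant under \<open>S\<^bsub>n-a\<^esub>\<close>. The image of such an \<open>h\<close> in the induced
  module depends only on its trivial character, up to which it is the indicator of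
  \<open>{1..a} \<subseteq> C\<close>. This gives the factorisation, the initial value and the recursion at once.
\<close>

subsection \<open>Inversions and reduced words\<close>

text \<open>Products are defined by right multiplications along words picked by \<open>SOME\<close>,
  and inverses by \<open>THE\<close>. The only form of associativity used is that left
  multiplication by \<open>T_i\<close> commutes with every \<open>rmul\<close>. It turns each
  \<open>LU n u\<close> into a composition of explicit operators on coefficient functions, and from
  then on only coefficients are compared. The element \<open>h\<close> of the overview is in general
  not a multiple of \<open>one_par\<close>; what the recursion keeps is right invariance under
  permutations of the last \<open>n - a\<close> points. This suffices: if
  \<open>{1..a} \<subseteq> C\<close>, then \<open>ucol n C\<close> fixes \<open>1, ..., a\<close>,
  commutes with \<open>S_a\<close> and can be moved to the right, where it is absorbed. A sum over
  \<open>S_a\<close> splits off as a scalar, and the rest is a quotient of Poincare polynomials that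
  matches the normalisation of \<open>psit\<close> for a pair. Every other first column is reached
  from \<open>{1..a}\<close> by linear operators, so the scalar survives all steps.\<close>

lemma sw_sw [simp]: "sw i (sw i k) = k"
  by (auto simp: sw_def)

lemma sw_apply [simp]: "sw i i = Suc i" "sw i (Suc i) = i"
  by (simp_all add: sw_def)

lemma sw_comp_sw [simp]: "sw i \<circ> sw i = id"
  by (auto simp: fun_eq_iff)

lemma sw_comp_sw_comp [simp]: "sw i \<circ> (sw i \<circ> v) = v"
  by (simp add: comp_assoc [symmetric])

lemma comp_sw_comp_sw [simp]: "v \<circ> sw i \<circ> sw i = v"
  by (simp add: comp_assoc)

lemma bij_sw: "bij (sw i)"
  by (rule o_bij [of "sw i"]) simp_all

lemma inv_sw [simp]: "inv (sw i) = sw i"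
  by (rule inv_unique_comp) simp_all

lemma sw_in_Sn: "i \<in> {1..<n} \<Longrightarrow> sw i \<in> Sn n"
  using bij_sw [of i] by (auto simp: Sn_def permutes_def bij_iff sw_def)

lemma Sn_id [simp]: "id \<in> Sn n"
  by (simp add: Sn_def permutes_id)

lemma Sn_comp: "u \<in> Sn n \<Longrightarrow> w \<in> Sn n \<Longrightarrow> u \<circ> w \<in> Sn n"
  by (simp add: Sn_def permutes_compose)

lemma Sn_inv: "w \<in> Sn n \<Longrightarrow> inv w \<in> Sn n"
  by (simp add: Sn_def permutes_inv)

lemma Sn_bij: "w \<in> Sn n \<Longrightarrow> bij w"
  by (auto simp: Sn_def permutes_bij)

lemma finite_Sn [simp]: "finite (Sn n)"
  by (simp add: Sn_def finite_permutations)

lemma Sn_range: "w \<in> Sn n \<Longrightarrow> w k \<in> {1..n} \<longleftrightarrow> k \<in> {1..n}"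
  unfolding Sn_def using permutes_in_image by fastforce

lemma Sn_eq_iff: "w \<in> Sn n \<Longrightarrow> w x = w y \<longleftrightarrow> x = y"
  using Sn_bij [of w n] by (auto simp: bij_def inj_eq)

lemma Sn_inv_eq: "w \<in> Sn n \<Longrightarrow> inv w (w k) = k" "w \<in> Sn n \<Longrightarrow> w (inv w k) = k"
  by (simp_all add: Sn_def permutes_inverses)

lemma Sn_inv_comp: "w \<in> Sn n \<Longrightarrow> inv w \<circ> w = id" "w \<in> Sn n \<Longrightarrow> w \<circ> inv w = id"
  by (simp_all add: fun_eq_iff Sn_inv_eq)

lemma Sn_inv_inv: "w \<in> Sn n \<Longrightarrow> inv (inv w) = w"
  by (simp add: Sn_bij inv_inv_eq)

lemma inv_comp_Sn: "u \<in> Sn n \<Longrightarrow> w \<in> Sn n \<Longrightarrow> inv (u \<circ> w) = inv w \<circ> inv u"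
  by (simp add: Sn_bij o_inv_distrib)

lemma sw_comp_in_Sn_iff: "i \<in> {1..<n} \<Longrightarrow> sw i \<circ> v \<in> Sn n \<longleftrightarrow> v \<in> Sn n"
  using Sn_comp [OF sw_in_Sn, of i n v] Sn_comp [OF sw_in_Sn, of i n "sw i \<circ> v"] by auto

lemma comp_sw_in_Sn_iff: "i \<in> {1..<n} \<Longrightarrow> v \<circ> sw i \<in> Sn n \<longleftrightarrow> v \<in> Sn n"
  using Sn_comp [OF _ sw_in_Sn, of v n i] Sn_comp [OF _ sw_in_Sn, of "v \<circ> sw i" n i] by auto

text \<open>If \<open>w\<close> fixes everything below \<open>k\<close>, injectivity gives
  \<open>k \<le> w k\<close> and \<open>k \<le> inv w k\<close>; were \<open>k < inv w k\<close>,
  monotonicity would give \<open>w k < k\<close>.\<close>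

lemma strict_mono_Sn_eq_id:
  assumes w: "w \<in> Sn n" and mono: "\<And>i j. 1 \<le> i \<Longrightarrow> i < j \<Longrightarrow> j \<le> n \<Longrightarrow> w i < w j"
  shows "w = id"
proof
  fix k
  show "w k = id k"
  proof (induction k rule: less_induct)
    case (less k)
    show ?case
    proof (cases "k \<in> {1..n}")
      case True
      have "w k \<ge> k"
        by (metis Sn_eq_iff id_apply less less_irrefl not_le w)
      moreover have "inv w k \<ge> k"
        by (metis Sn_inv_eq(2) id_apply less less_irrefl not_le w)
      moreover have "inv w k \<in> {1..n}"
        using Sn_range [OF Sn_inv [OF w]] True by blast
      ultimately show ?thesis
        using mono [of k "inv w k"] True Sn_inv_eq(2) [OF w, of k]
        by (cases "inv w k = k") auto
    next
      case False
      then show ?thesis using w by (simp add: Sn_def permutes_def)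
    qed
  qed
qed

lemma finite_invs: "finite {(i, j). 1 \<le> i \<and> i < j \<and> j \<le> n \<and> P i j}" for n :: nat
  by (rule finite_subset [of _ "{1..n} \<times> {1..n}"]) auto

text \<open>By hypothesis the inversions of \<open>w\<close> stay inverted under \<open>u\<close>.
  The remaining inversions of \<open>u \<circ> w\<close> are carried by \<open>w\<close> onto those
  of \<open>u\<close>: an inversion of \<open>u\<close> arising from an inversion of
  \<open>w\<close> would contradict the hypothesis.\<close>

lemma len_comp:
  assumes u: "u \<in> Sn n" and w: "w \<in> Sn n"
    and inv: "\<And>i j. 1 \<le> i \<Longrightarrow> i < j \<Longrightarrow> j \<le> n \<Longrightarrow> w j < w i \<Longrightarrow> u (w j) < u (w i)"
  shows "len n (u \<circ> w) = len n u + len n w"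
proof -
  let ?I = "{(i, j). 1 \<le> i \<and> i < j \<and> j \<le> n \<and> w j < w i}"
  let ?B = "{(i, j). 1 \<le> i \<and> i < j \<and> j \<le> n \<and> (w i < w j \<and> u (w j) < u (w i))}"
  have neq: "w i \<noteq> w j" if "i < j" for i j
    using that Sn_eq_iff [OF w] by auto
  have "{(i, j). 1 \<le> i \<and> i < j \<and> j \<le> n \<and> (u \<circ> w) j < (u \<circ> w) i} = ?I \<union> ?B"
    using inv neq by auto (metis less_linear)
  then have "len n (u \<circ> w) = card ?I + card ?B"
    unfolding len_def using card_Un_disjoint [OF finite_invs finite_invs] by (simp add: disjoint_iff)
  moreover have "bij_betw (\<lambda>(i, j). (w i, w j)) ?B {(i, j). 1 \<le> i \<and> i < j \<and> j \<le> n \<and> u j < u i}"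
  proof (rule bij_betw_byWitness [where f' = "\<lambda>(i, j). (inv w i, inv w j)"])
    show "(\<lambda>(i, j). (w i, w j)) ` ?B \<subseteq> {(i, j). 1 \<le> i \<and> i < j \<and> j \<le> n \<and> u j < u i}"
      using Sn_range [OF w] by fastforce
    show "(\<lambda>(i, j). (inv w i, inv w j)) ` {(i, j). 1 \<le> i \<and> i < j \<and> j \<le> n \<and> u j < u i} \<subseteq> ?B"
    proof clarsimp
      fix p q assume pq: "Suc 0 \<le> p" "p < q" "q \<le> n" "u q < u p"
      have r: "inv w p \<in> {1..n}" "inv w q \<in> {1..n}"
        using Sn_range [OF Sn_inv [OF w]] pq by auto
      have "inv w p < inv w q"
      proof (rule ccontr)
        assume "\<not> ?thesis"
        moreover have "inv w p \<noteq> inv w q"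
          using pq Sn_eq_iff [OF Sn_inv [OF w]] by auto
        ultimately have "u p < u q"
          using inv [of "inv w q" "inv w p"] r pq by (simp add: Sn_inv_eq [OF w])
        then show False using pq by simp
      qed
      then show "Suc 0 \<le> inv w p \<and> inv w p < inv w q \<and> inv w q \<le> n \<and>
          w (inv w p) < w (inv w q) \<and> u (w (inv w q)) < u (w (inv w p))"
        using r pq by (simp add: Sn_inv_eq [OF w])
    qed
  qed (auto simp: Sn_inv_eq [OF w])
  ultimately show ?thesis
    by (simp add: len_def bij_betw_same_card)
qed

lemma len_inv:
  assumes w: "w \<in> Sn n"
  shows "len n (inv w) = len n w"
proof -
  have "bij_betw (\<lambda>(i, j). (w j, w i)) {(i, j). 1 \<le> i \<and> i < j \<and> j \<le> n \<and> w j < w i}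
      {(i, j). 1 \<le> i \<and> i < j \<and> j \<le> n \<and> inv w j < inv w i}"
  proof (rule bij_betw_byWitness [where f' = "\<lambda>(i, j). (inv w j, inv w i)"])
    show "(\<lambda>(i, j). (w j, w i)) ` {(i, j). 1 \<le> i \<and> i < j \<and> j \<le> n \<and> w j < w i}
        \<subseteq> {(i, j). 1 \<le> i \<and> i < j \<and> j \<le> n \<and> inv w j < inv w i}"
      using Sn_range [OF w] by (fastforce simp: Sn_inv_eq [OF w])
    show "(\<lambda>(i, j). (inv w j, inv w i)) ` {(i, j). 1 \<le> i \<and> i < j \<and> j \<le> n \<and> inv w j < inv w i}
        \<subseteq> {(i, j). 1 \<le> i \<and> i < j \<and> j \<le> n \<and> w j < w i}"
      using Sn_range [OF Sn_inv [OF w]] by (fastforce simp: Sn_inv_eq [OF w])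
  qed (auto simp: Sn_inv_eq [OF w])
  then show ?thesis
    by (simp add: len_def bij_betw_same_card)
qed

lemma len_id [simp]: "len n id = 0"
proof -
  have "{(i, j). 1 \<le> i \<and> i < j \<and> j \<le> n \<and> id j < id i} = {}"
    by auto
  then show ?thesis by (simp only: len_def card.empty)
qed

lemma len_sw: "i \<in> {1..<n} \<Longrightarrow> len n (sw i) = 1"
proof -
  assume "i \<in> {1..<n}"
  then have "{(p, q). 1 \<le> p \<and> p < q \<and> q \<le> n \<and> sw i q < sw i p} = {(i, Suc i)}"
    by (auto simp: sw_def split: if_splits)
  then show ?thesis by (simp add: len_def)
qed

lemma len_comp_sw:
  assumes v: "v \<in> Sn n" and i: "i \<in> {1..<n}" and less: "v i < v (Suc i)"
  shows "len n (v \<circ> sw i) = Suc (len n v)"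
proof -
  have "len n (v \<circ> sw i) = len n v + len n (sw i)"
    using less by (intro len_comp v sw_in_Sn i) (auto simp: sw_def split: if_splits)
  then show ?thesis by (simp add: len_sw [OF i])
qed

lemma len_comp_sw':
  assumes v: "v \<in> Sn n" and i: "i \<in> {1..<n}" and less: "v (Suc i) < v i"
  shows "len n v = Suc (len n (v \<circ> sw i))"
  using len_comp_sw [of "v \<circ> sw i" n i] less v i comp_sw_in_Sn_iff [OF i, of v]
  by simp

lemma len_comp_sw_less_iff:
  assumes v: "v \<in> Sn n" and i: "i \<in> {1..<n}"
  shows "len n (v \<circ> sw i) < len n v \<longleftrightarrow> v (Suc i) < v i"
  using len_comp_sw [OF v i] len_comp_sw' [OF v i] Sn_eq_iff [OF v, of i "Suc i"]
  by (cases "v i" "v (Suc i)" rule: linorder_cases) auto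

lemma len_comp_sw_le:
  assumes v: "v \<in> Sn n" and i: "i \<in> {1..<n}"
  shows "len n (v \<circ> sw i) \<le> Suc (len n v)"
  using len_comp_sw [OF v i] len_comp_sw' [OF v i] Sn_eq_iff [OF v, of i "Suc i"]
  by (cases "v i" "v (Suc i)" rule: linorder_cases) auto

lemma len_sw_comp_eq:
  assumes v: "v \<in> Sn n" and i: "i \<in> {1..<n}"
  shows "len n (sw i \<circ> v) = len n (inv v \<circ> sw i)"
proof -
  have "len n (sw i \<circ> v) = len n (inv (sw i \<circ> v))"
    by (rule len_inv [symmetric]) (simp add: sw_comp_in_Sn_iff [OF i] v)
  also have "inv (sw i \<circ> v) = inv v \<circ> sw i"
    by (simp add: inv_comp_Sn [OF sw_in_Sn [OF i] v])
  finally show ?thesis .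
qed

lemma len_sw_comp:
  assumes v: "v \<in> Sn n" and i: "i \<in> {1..<n}" and less: "inv v i < inv v (Suc i)"
  shows "len n (sw i \<circ> v) = Suc (len n v)"
  by (simp add: len_sw_comp_eq [OF v i] len_comp_sw [OF Sn_inv [OF v] i less] len_inv [OF v])

lemma inv_sw_comp: "v \<in> Sn n \<Longrightarrow> i \<in> {1..<n} \<Longrightarrow> inv (sw i \<circ> v) k = inv v (sw i k)"
  by (subst inv_comp_Sn [OF sw_in_Sn]) simp_all

section \<open>Words in simple transpositions\<close>

definition word :: "nat list \<Rightarrow> nat \<Rightarrow> nat" where
  "word is = foldr (\<lambda>i f. sw i \<circ> f) is id"

lemma word_simps [simp]: "word [] = id" "word (i # is) = sw i \<circ> word is"
  by (simp_all add: word_def)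

lemma word_append: "word (is @ js) = word is \<circ> word js"
  by (induction "is") (simp_all add: comp_assoc)

lemma word_in_Sn: "set is \<subseteq> {1..<n} \<Longrightarrow> word is \<in> Sn n"
proof (induction "is")
  case (Cons i "is")
  then have "sw i \<in> Sn n" "word is \<in> Sn n"
    using sw_in_Sn [of i n] by auto
  then show ?case by (simp only: word_simps Sn_comp)
qed simp

lemma len_comp_word_le:
  "set is \<subseteq> {1..<n} \<Longrightarrow> v \<in> Sn n \<Longrightarrow> len n (v \<circ> word is) \<le> len n v + length is"
proof (induction "is" arbitrary: v)
  case (Cons i "is")
  then have "len n (v \<circ> sw i \<circ> word is) \<le> len n (v \<circ> sw i) + length is"
    by (intro Cons.IH Sn_comp sw_in_Sn) auto
  also have "\<dots> \<le> len n v + length (i # is)"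
    using Cons.prems len_comp_sw_le [of v n i] by simp
  finally show ?case
    by (simp only: word_simps comp_assoc)
qed auto

definition redw :: "nat \<Rightarrow> nat list \<Rightarrow> (nat \<Rightarrow> nat) \<Rightarrow> bool" where
  "redw n is w \<longleftrightarrow> set is \<subseteq> {1..<n} \<and> length is = len n w \<and> w = word is"

text \<open>Ascents at all neighbours add up to monotonicity, which leaves only
  \<open>id\<close>.\<close>

lemma ex_descent:
  assumes w: "w \<in> Sn n" and "w \<noteq> id"
  obtains i where "i \<in> {1..<n}" "w (Suc i) < w i"
proof (rule ccontr)
  assume "\<not> thesis"
  then have less: "w i < w (Suc i)" if "i \<in> {1..<n}" for i
    using that \<open>\<And>i. i \<in> {1..<n} \<Longrightarrow> w (Suc i) < w i \<Longrightarrow> thesis\<close> Sn_eq_iff [OF w, of i "Suc i"]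
    by (metis n_not_Suc_n not_less_iff_gr_or_eq)
  have "w i < w j" if "1 \<le> i" "i < j" "j \<le> n" for i j
    using that(2,1,3)
  proof (induction rule: less_Suc_induct)
    case (1 i) then show ?case using less by auto
  next
    case (2 i j k) then show ?case by force
  qed
  then show False
    using strict_mono_Sn_eq_id [OF w] \<open>w \<noteq> id\<close> by blast
qed

lemma ex_redw: "w \<in> Sn n \<Longrightarrow> \<exists>is. redw n is w"
proof (induction "len n w" arbitrary: w rule: less_induct)
  case less
  show ?case
  proof (cases "w = id")
    case True
    then show ?thesis by (intro exI [of _ "[]"]) (simp add: redw_def)
  next
    case False
    then obtain i where i: "i \<in> {1..<n}" "w (Suc i) < w i"
      using ex_descent less.prems by blast
    then have l: "len n w = Suc (len n (w \<circ> sw i))"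
      using len_comp_sw' less.prems by blast
    then obtain "is" where "redw n is (w \<circ> sw i)"
      using less.hyps [of "w \<circ> sw i"] less.prems i by (auto simp: comp_sw_in_Sn_iff)
    then have "redw n (is @ [i]) w"
      using i l by (auto simp: redw_def word_append) (metis comp_sw_comp_sw)
    then show ?thesis by blast
  qed
qed

lemma redw_redword: "w \<in> Sn n \<Longrightarrow> redw n (redword n w) w"
  using someI_ex [OF ex_redw [unfolded redw_def word_def]]
  by (simp add: redw_def redword_def word_def)

subsection \<open>The inverse of a basis element\<close>

lemma sw_less_iff:
  "{x, y} \<noteq> {i, Suc i} \<Longrightarrow> sw i x < sw i y \<longleftrightarrow> x < y"
  by (auto simp: sw_def)

text \<open>The one configuration in which a left and a right multiplication interact:
  \<open>v\<close> conjugates \<open>sw j\<close> to \<open>sw i\<close>.\<close>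

lemma sw_comp_eq_comp_sw:
  assumes v: "v \<in> Sn n" and eq: "{v j, v (Suc j)} = {i, Suc i}"
  shows "sw i \<circ> v = v \<circ> sw j"
proof
  fix k
  consider "v j = i" "v (Suc j) = Suc i" | "v j = Suc i" "v (Suc j) = i"
    using eq by (auto simp: doubleton_eq_iff)
  then show "(sw i \<circ> v) k = (v \<circ> sw j) k"
    using Sn_eq_iff [OF v, of k j] Sn_eq_iff [OF v, of k "Suc j"]
    by cases (auto simp: sw_def)
qed

text \<open>The coefficients of \<open>T_i h\<close>, mirroring \<open>rmul\<close>: a left descent
  of \<open>v\<close> is a right descent of \<open>inv v\<close>, hence the comparison of the
  positions of \<open>i\<close> and \<open>Suc i\<close>.\<close>

definition lmul :: "nat \<Rightarrow> nat \<Rightarrow> hecke \<Rightarrow> hecke" where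
  "lmul n i h = (\<lambda>v. if v \<notin> Sn n then 0
     else if inv v (Suc i) < inv v i then (tt - 1) * h v + h (sw i \<circ> v)
     else tt * h (sw i \<circ> v))"

text \<open>Left multiplication by \<open>t T\<^sub>i\<^sup>-\<^sup>1 = T\<^sub>i + 1 - t\<close>.\<close>
definition Lop :: "nat \<Rightarrow> nat \<Rightarrow> hecke \<Rightarrow> hecke" where
  "Lop n i h = (\<lambda>v. lmul n i h v + (1 - tt) * h v)"

text \<open>Unless \<open>v\<close> maps \<open>{j, Suc j}\<close> onto \<open>{i, Suc i}\<close>,
  multiplying by one transposition does not affect the descent test for the other. In the
  exceptional case \<open>sw i \<circ> v = v \<circ> sw j\<close>, both tests agree, and both
  operators act alike on the two coefficients.\<close>

lemma lmul_rmul_commute: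
  assumes i: "i \<in> {1..<n}" and j: "j \<in> {1..<n}"
  shows "lmul n i (rmul n j h) = rmul n j (lmul n i h)"
proof
  fix v
  show "lmul n i (rmul n j h) v = rmul n j (lmul n i h) v"
  proof (cases "v \<in> Sn n")
    case v: True
    define R where "R w \<longleftrightarrow> w (Suc j) < w j" for w :: "nat \<Rightarrow> nat"
    define L where "L w \<longleftrightarrow> inv w (Suc i) < inv w i" for w :: "nat \<Rightarrow> nat"
    have r: "rmul n j g w = (if R w then (tt - 1) * g w + g (w \<circ> sw j) else tt * g (w \<circ> sw j))"
      if "w \<in> Sn n" for g w
      using that by (simp add: rmul_def R_def len_comp_sw_less_iff [OF that j])
    have l: "lmul n i g w = (if L w then (tt - 1) * g w + g (sw i \<circ> w) else tt * g (sw i \<circ> w))"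
      if "w \<in> Sn n" for g w
      using that by (simp add: lmul_def L_def)
    have v': "sw i \<circ> v \<in> Sn n" and v'': "v \<circ> sw j \<in> Sn n"
      using v by (simp_all only: sw_comp_in_Sn_iff [OF i] comp_sw_in_Sn_iff [OF j])
    have inv'': "inv (v \<circ> sw j) = sw j \<circ> inv v"
      by (subst inv_comp_Sn [OF v sw_in_Sn [OF j]]) simp
    show ?thesis
    proof (cases "{v j, v (Suc j)} = {i, Suc i}")
      case True
      then have eq: "sw i \<circ> v = v \<circ> sw j"
        using sw_comp_eq_comp_sw [OF v] by blast
      from True consider "v j = i" "v (Suc j) = Suc i" | "v j = Suc i" "v (Suc j) = i"
        by (auto simp: doubleton_eq_iff)
      then have "(R v \<longleftrightarrow> L v) \<and> (R (v \<circ> sw j) \<longleftrightarrow> \<not> R v) \<and> (L (v \<circ> sw j) \<longleftrightarrow> \<not> L v)"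
      proof cases
        case 1
        then have "inv v i = j" "inv v (Suc i) = Suc j"
          using Sn_inv_eq(1) [OF v] by metis+
        with 1 show ?thesis by (simp add: R_def L_def inv'')
      next
        case 2
        then have "inv v i = Suc j" "inv v (Suc i) = j"
          using Sn_inv_eq(1) [OF v] by metis+
        with 2 show ?thesis by (simp add: R_def L_def inv'')
      qed
      then show ?thesis
        unfolding r [OF v] l [OF v] l [OF v''] eq r [OF v'']
        using eq by (simp add: algebra_simps flip: comp_assoc)
    next
      case False
      have "R (sw i \<circ> v) \<longleftrightarrow> R v"
        using sw_less_iff [of "v (Suc j)" "v j" i] False by (simp add: R_def insert_commute)
      moreover have "L (v \<circ> sw j) \<longleftrightarrow> L v"
      proof -
        have "{inv v (Suc i), inv v i} \<noteq> {j, Suc j}"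
        proof
          assume "{inv v (Suc i), inv v i} = {j, Suc j}"
          then have "v ` {inv v (Suc i), inv v i} = v ` {j, Suc j}" by simp
          then show False using False by (simp add: Sn_inv_eq [OF v] insert_commute)
        qed
        then show ?thesis
          using sw_less_iff [of "inv v (Suc i)" "inv v i" j] by (simp add: L_def inv'')
      qed
      ultimately show ?thesis
        unfolding r [OF v] l [OF v] l [OF v''] r [OF v'] comp_assoc by (simp add: algebra_simps)
    qed
  qed (simp add: lmul_def rmul_def)
qed

lemma rmul_add: "rmul n j (\<lambda>v. g v + h v) = (\<lambda>v. rmul n j g v + rmul n j h v)"
  by (auto simp: rmul_def algebra_simps)

lemma rmul_scale: "rmul n j (\<lambda>v. c * h v) = (\<lambda>v. c * rmul n j h v)"
  by (auto simp: rmul_def algebra_simps)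

lemma Lop_rmul_commute:
  "i \<in> {1..<n} \<Longrightarrow> j \<in> {1..<n} \<Longrightarrow> Lop n i (rmul n j h) = rmul n j (Lop n i h)"
  unfolding Lop_def rmul_add rmul_scale by (simp only: lmul_rmul_commute)

lemma lmul_lin: "lmul n i (\<lambda>v. \<Sum>w\<in>A. c w * f w v) = (\<lambda>v. \<Sum>w\<in>A. c w * lmul n i (f w) v)"
  by (auto simp: lmul_def sum_distrib_left sum.distrib [symmetric] algebra_simps intro!: ext sum.cong)

lemma Lop_lin: "Lop n i (\<lambda>v. \<Sum>w\<in>A. c w * f w v) = (\<lambda>v. \<Sum>w\<in>A. c w * Lop n i (f w) v)"
  unfolding Lop_def lmul_lin
  by (auto simp: sum_distrib_left sum.distrib [symmetric] algebra_simps intro!: ext sum.cong)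

lemma set_redword: "w \<in> Sn n \<Longrightarrow> set (redword n w) \<subseteq> {1..<n}"
  using redw_redword by (simp add: redw_def)

lemma fold_commute_op:
  assumes "\<And>j x. j \<in> set js \<Longrightarrow> f (g j x) = g j (f x)"
  shows "f (fold g js x) = fold g js (f x)"
  using assms by (induction js arbitrary: x) auto

text \<open>An instance of associativity: \<open>hmul n x y\<close> is a linear combination of
  iterated right multiplications of \<open>x\<close>, and \<open>lmul\<close> commutes with each of
  them.\<close>

lemma hmul_lmul: "i \<in> {1..<n} \<Longrightarrow> hmul n (lmul n i x) y = lmul n i (hmul n x y)"
  unfolding hmul_def lmul_lin
proof (intro ext sum.cong refl arg_cong2 [of _ _ _ _ "(*)"])
  fix v w assume "i \<in> {1..<n}" "w \<in> Sn n"
  then have "lmul n i (rmulT n w x) = rmulT n w (lmul n i x)"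
    unfolding rmulT_def using set_redword by (intro fold_commute_op lmul_rmul_commute) blast+
  then show "rmulT n w (lmul n i x) v = lmul n i (rmulT n w x) v" by simp
qed

lemma hmul_Lop: "i \<in> {1..<n} \<Longrightarrow> hmul n (Lop n i x) y = Lop n i (hmul n x y)"
  unfolding hmul_def Lop_lin
proof (intro ext sum.cong refl arg_cong2 [of _ _ _ _ "(*)"])
  fix v w assume "i \<in> {1..<n}" "w \<in> Sn n"
  then have "Lop n i (rmulT n w x) = rmulT n w (Lop n i x)"
    unfolding rmulT_def using set_redword by (intro fold_commute_op Lop_rmul_commute) blast+
  then show "rmulT n w (Lop n i x) v = Lop n i (rmulT n w x) v" by simp
qed

lemma fold_rmul_scale: "fold (rmul n) js (\<lambda>v. c * h v) = (\<lambda>v. c * fold (rmul n) js h v)"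
  by (induction js arbitrary: h) (simp_all add: rmul_scale)

lemma hmul_hsmult: "hmul n (hsmult c x) y = hsmult c (hmul n x y)"
  by (simp add: hmul_def hsmult_def rmulT_def fold_rmul_scale sum_distrib_left algebra_simps)

lemma Hn_outside: "h \<in> Hn n \<Longrightarrow> v \<notin> Sn n \<Longrightarrow> h v = 0"
  by (auto simp: Hn_def)

lemma HnI: "(\<And>v. v \<notin> Sn n \<Longrightarrow> h v = 0) \<Longrightarrow> h \<in> Hn n"
  by (auto simp: Hn_def)

lemma Lop_in_Hn: "h \<in> Hn n \<Longrightarrow> Lop n i h \<in> Hn n"
  by (auto simp: Hn_def Lop_def lmul_def)

lemma lmul_in_Hn: "lmul n i h \<in> Hn n"
  by (auto simp: Hn_def lmul_def)

lemma hone_in_Hn: "hone \<in> Hn n"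
  by (auto simp: Hn_def hone_def Tb_def)

lemma Lop_apply:
  "v \<in> Sn n \<Longrightarrow> Lop n i h v = (if inv v (Suc i) < inv v i then h (sw i \<circ> v)
     else tt * h (sw i \<circ> v) + (1 - tt) * h v)"
  by (auto simp: Lop_def lmul_def algebra_simps)

lemma inv_i_neq: "v \<in> Sn n \<Longrightarrow> inv v i \<noteq> inv v (Suc i)"
  using Sn_eq_iff [OF Sn_inv] by fastforce

text \<open>The quadratic relation in the form \<open>T_i (T_i + 1 - t) = t\<close>, checked on the
  pair \<open>v\<close>, \<open>sw i \<circ> v\<close>.\<close>

lemma lmul_Lop:
  assumes i: "i \<in> {1..<n}" and h: "h \<in> Hn n"
  shows "lmul n i (Lop n i h) = hsmult tt h" "Lop n i (lmul n i h) = hsmult tt h"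
proof -
  have *: "lmul n i (Lop n i h) v = tt * h v \<and> Lop n i (lmul n i h) v = tt * h v" for v
  proof (cases "v \<in> Sn n")
    case v: True
    have v': "sw i \<circ> v \<in> Sn n"
      using v by (simp only: sw_comp_in_Sn_iff [OF i])
    show ?thesis
      using inv_i_neq [OF v, of i]
      by (auto simp: Lop_apply v v' lmul_def inv_sw_comp [OF v i] algebra_simps)
  qed (simp add: Hn_outside [OF h] Lop_def lmul_def)
  then show "lmul n i (Lop n i h) = hsmult tt h" "Lop n i (lmul n i h) = hsmult tt h"
    by (simp_all add: hsmult_def fun_eq_iff)
qed

lemma Lop_hsmult: "Lop n i (hsmult c h) = hsmult c (Lop n i h)"
  by (auto simp: Lop_def lmul_def hsmult_def algebra_simps)

lemma lmul_hsmult: "lmul n i (hsmult c h) = hsmult c (lmul n i h)"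
  by (auto simp: lmul_def hsmult_def algebra_simps)

lemma hsmult_hsmult: "hsmult c (hsmult d h) = hsmult (c * d) h"
  by (simp add: hsmult_def mult.assoc)

lemma foldr_Lop_in_Hn: "h \<in> Hn n \<Longrightarrow> foldr (Lop n) is h \<in> Hn n"
  by (induction "is") (simp_all add: Lop_in_Hn)

lemma fold_lmul_in_Hn: "h \<in> Hn n \<Longrightarrow> fold (lmul n) is h \<in> Hn n"
  by (induction "is" arbitrary: h) (simp_all add: lmul_in_Hn)

lemma fold_lmul_hsmult: "fold (lmul n) is (hsmult c h) = hsmult c (fold (lmul n) is h)"
  by (induction "is" arbitrary: h) (simp_all add: lmul_hsmult)

text \<open>\<open>foldr\<close> applies the last letter first and \<open>fold\<close> the first
  letter first, so the operators meet in inverse order and cancel pairwise, each pair leaving a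
  factor \<open>tt\<close>.\<close>

lemma fold_lmul_foldr_Lop:
  "set is \<subseteq> {1..<n} \<Longrightarrow> h \<in> Hn n \<Longrightarrow>
    fold (lmul n) is (foldr (Lop n) is h) = hsmult (tt ^ length is) h"
proof (induction "is")
  case (Cons i "is")
  then have "lmul n i (Lop n i (foldr (Lop n) is h)) = hsmult tt (foldr (Lop n) is h)"
    by (intro lmul_Lop foldr_Lop_in_Hn) auto
  with Cons show ?case by (simp add: fold_lmul_hsmult hsmult_hsmult)
qed (simp add: hsmult_def)

lemma foldr_Lop_fold_lmul:
  "set is \<subseteq> {1..<n} \<Longrightarrow> h \<in> Hn n \<Longrightarrow>
    foldr (Lop n) is (fold (lmul n) is h) = hsmult (tt ^ length is) h"
proof (induction "is" arbitrary: h)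
  case (Cons i "is")
  then have "foldr (Lop n) is (fold (lmul n) is (lmul n i h)) = hsmult (tt ^ length is) (lmul n i h)"
    by (intro Cons.IH lmul_in_Hn) auto
  moreover have "Lop n i (lmul n i h) = hsmult tt h"
    using Cons.prems by (intro lmul_Lop) auto
  ultimately show ?case by (simp add: Lop_hsmult hsmult_hsmult mult.commute)
qed (simp add: hsmult_def)

section \<open>Products and inverses of basis elements\<close>

lemma rmul_Tb:
  assumes v: "v \<in> Sn n" and i: "i \<in> {1..<n}" and less: "v i < v (Suc i)"
  shows "rmul n i (Tb v) = Tb (v \<circ> sw i)"
proof
  fix w
  have "w = v \<circ> sw i \<longleftrightarrow> w \<circ> sw i = v"
    by (metis comp_sw_comp_sw)
  moreover have "v \<circ> sw i \<in> Sn n"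
    using v by (simp only: comp_sw_in_Sn_iff [OF i])
  moreover have "v \<noteq> v \<circ> sw i"
    using less by (metis comp_apply less_irrefl sw_apply(1))
  ultimately show "rmul n i (Tb v) w = Tb (v \<circ> sw i) w"
    using len_comp_sw [OF v i less] v by (auto simp: rmul_def Tb_def)
qed

lemma lmul_Tb:
  assumes v: "v \<in> Sn n" and i: "i \<in> {1..<n}" and less: "inv v i < inv v (Suc i)"
  shows "lmul n i (Tb v) = Tb (sw i \<circ> v)"
proof
  fix w
  have "w = sw i \<circ> v \<longleftrightarrow> sw i \<circ> w = v"
    by (metis sw_comp_sw_comp)
  moreover have "sw i \<circ> v \<in> Sn n"
    using v by (simp only: sw_comp_in_Sn_iff [OF i])
  moreover have "v \<noteq> sw i \<circ> v"
    using less inv_sw_comp [OF v i, of i] by force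
  ultimately show "lmul n i (Tb v) w = Tb (sw i \<circ> v) w"
    using less v by (auto simp: lmul_def Tb_def inv_sw_comp [OF v i])
qed

text \<open>Length additivity forces an ascent at every letter: a descent would lose length that the
  remaining letters cannot make up.\<close>

lemma fold_rmul_Tb:
  "set is \<subseteq> {1..<n} \<Longrightarrow> u \<in> Sn n \<Longrightarrow> len n (u \<circ> word is) = len n u + length is \<Longrightarrow>
    fold (rmul n) is (Tb u) = Tb (u \<circ> word is)"
proof (induction "is" arbitrary: u)
  case (Cons i "is")
  then have i: "i \<in> {1..<n}" and "is": "set is \<subseteq> {1..<n}" by auto
  have u': "u \<circ> sw i \<in> Sn n"
    using Cons.prems by (simp only: comp_sw_in_Sn_iff [OF i])
  have eq: "u \<circ> word (i # is) = u \<circ> sw i \<circ> word is"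
    by (simp only: word_simps comp_assoc)
  have less: "u i < u (Suc i)"
  proof (rule ccontr)
    assume "\<not> ?thesis"
    then have "u (Suc i) < u i"
      using Sn_eq_iff [OF Cons.prems(2), of i "Suc i"] by linarith
    then have "len n (u \<circ> sw i) < len n u"
      using len_comp_sw' [OF Cons.prems(2) i] by simp
    then show False
      using len_comp_word_le [OF "is" u'] Cons.prems(3) unfolding eq by simp
  qed
  have "len n (u \<circ> sw i \<circ> word is) = len n u + length (i # is)"
    using Cons.prems(3) by (simp only: eq)
  also have "\<dots> = len n (u \<circ> sw i) + length is"
    using len_comp_sw [OF Cons.prems(2) i less] by simp
  finally have "fold (rmul n) is (Tb (u \<circ> sw i)) = Tb (u \<circ> sw i \<circ> word is)"
    by (rule Cons.IH [OF "is" u'])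
  then have "fold (rmul n) (i # is) (Tb u) = Tb (u \<circ> word (i # is))"
    unfolding eq by (simp add: rmul_Tb [OF Cons.prems(2) i less])
  then show ?case .
qed simp

lemma rmulT_Tb:
  assumes "u \<in> Sn n" "w \<in> Sn n" "len n (u \<circ> w) = len n u + len n w"
  shows "rmulT n w (Tb u) = Tb (u \<circ> w)"
  using fold_rmul_Tb [of "redword n w" n u] redw_redword [OF assms(2)] assms
  by (simp add: rmulT_def redw_def)

lemma hmul_hone: "y \<in> Hn n \<Longrightarrow> hmul n hone y = y"
proof
  fix v assume y: "y \<in> Hn n"
  have "hmul n hone y v = (\<Sum>w\<in>Sn n. y w * Tb w v)"
    unfolding hmul_def hone_def by (intro sum.cong refl) (simp add: rmulT_Tb)
  also have "\<dots> = (\<Sum>w\<in>Sn n. if v = w then y w else 0)"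
    by (intro sum.cong refl) (simp add: Tb_def)
  also have "\<dots> = y v"
    using Hn_outside [OF y, of v] by auto
  finally show "hmul n hone y v = y v" .
qed

lemma redw_prefix:
  assumes "redw n (is @ [k]) u"
  shows "redw n is (u \<circ> sw k)"
proof -
  have s: "set is \<subseteq> {1..<n}" and k: "k \<in> {1..<n}" and u: "u = word is \<circ> sw k"
    and l: "len n u = Suc (length is)"
    using assms by (auto simp: redw_def word_append)
  have "len n (word is) \<le> length is"
    using len_comp_word_le [OF s Sn_id] by simp
  moreover have "len n u \<le> Suc (len n (word is))"
    unfolding u by (intro len_comp_sw_le word_in_Sn s k)
  ultimately show ?thesis
    using s u l by (simp add: redw_def)
qed

text \<open>\<open>fold\<close> applies the first letter first, so the right-hand side is the
  product of the \<open>T_i\<close> over the reversed word, which is a reduced word of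
  \<open>inv u\<close>.\<close>

lemma Tb_inv_eq_fold_lmul:
  "redw n is u \<Longrightarrow> Tb (inv u) = fold (lmul n) is hone"
proof (induction "is" arbitrary: u rule: rev_induct)
  case Nil
  then have "u = id" by (simp add: redw_def)
  then show ?case by (simp add: hone_def id_def)
next
  case (snoc k "is")
  let ?w = "u \<circ> sw k"
  have w: "redw n is ?w" and k: "k \<in> {1..<n}"
    using snoc.prems redw_prefix by (auto simp: redw_def)
  have wS: "?w \<in> Sn n"
    using w word_in_Sn by (simp add: redw_def)
  then have u: "u \<in> Sn n"
    by (simp only: comp_sw_in_Sn_iff [OF k])
  have "len n u = Suc (len n ?w)"
    using w snoc.prems by (simp add: redw_def)
  then have "u (Suc k) < u k"
    using len_comp_sw_less_iff [OF u k] by simp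
  then have "lmul n k (Tb (inv ?w)) = Tb (sw k \<circ> inv ?w)"
    by (intro lmul_Tb Sn_inv wS k) (simp add: Sn_inv_inv [OF wS])
  also have "sw k \<circ> inv ?w = inv u"
    unfolding inv_comp_Sn [OF u sw_in_Sn [OF k]] inv_sw by simp
  finally show ?case
    using snoc.IH [OF w] by simp
qed

lemma hmul_fold_lmul:
  "set is \<subseteq> {1..<n} \<Longrightarrow> hmul n (fold (lmul n) is x) y = fold (lmul n) is (hmul n x y)"
  by (induction "is" arbitrary: x) (simp_all add: hmul_lmul)

lemma hmul_foldr_Lop:
  "set is \<subseteq> {1..<n} \<Longrightarrow> hmul n (foldr (Lop n) is x) y = foldr (Lop n) is (hmul n x y)"
  by (induction "is") (simp_all add: hmul_Lop)

text \<open>\<open>int poly\<close> is ordered by the sign of the leading coefficient. Positivity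
  shows at once that powers of \<open>tt\<close> and the sums \<open>Wpoly\<close> do not
  vanish.\<close>

lemma tt_pos: "0 < tt"
  by (simp add: tt_def zero_less_Fract_iff less_poly_def pos_poly_def)

text \<open>A definite description requires uniqueness too. It comes from the same cancellation:
  applying \<open>foldr (Lop n) is\<close> to \<open>fold (lmul n) is z = hone\<close> recovers
  \<open>z\<close> up to a power of \<open>tt\<close>.\<close>

lemma hinv_Tb_inv:
  assumes r: "redw n is u"
  shows "hinv n (Tb (inv u)) = hsmult (inverse (tt ^ length is)) (foldr (Lop n) is hone)"
    (is "_ = ?y")
  unfolding hinv_def
proof (rule the_equality)
  have s: "set is \<subseteq> {1..<n}"
    using r by (simp add: redw_def)
  note T = Tb_inv_eq_fold_lmul [OF r]
  have c: "tt ^ length is \<noteq> 0"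
    using tt_pos by simp
  have one: "hsmult 1 h = h" for h
    by (simp add: hsmult_def)
  have y: "?y \<in> Hn n"
    using foldr_Lop_in_Hn [OF hone_in_Hn, of n "is"] by (auto simp: Hn_def hsmult_def)
  have "hmul n (Tb (inv u)) ?y = hone"
    unfolding T hmul_fold_lmul [OF s] hmul_hone [OF y]
    using c by (simp add: fold_lmul_hsmult fold_lmul_foldr_Lop [OF s hone_in_Hn] hsmult_hsmult one)
  moreover have "hmul n ?y (Tb (inv u)) = hone"
    unfolding T hmul_hsmult hmul_foldr_Lop [OF s] hmul_hone [OF fold_lmul_in_Hn [OF hone_in_Hn]]
    using c by (simp add: foldr_Lop_fold_lmul [OF s hone_in_Hn] hsmult_hsmult one)
  ultimately show "?y \<in> Hn n \<and> hmul n (Tb (inv u)) ?y = hone \<and> hmul n ?y (Tb (inv u)) = hone"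
    using y by simp
  fix z assume z: "z \<in> Hn n \<and> hmul n (Tb (inv u)) z = hone \<and> hmul n z (Tb (inv u)) = hone"
  then have "fold (lmul n) is z = hone"
    by (metis T hmul_fold_lmul [OF s] hmul_hone)
  then have "foldr (Lop n) is hone = hsmult (tt ^ length is) z"
    using foldr_Lop_fold_lmul [OF s, of z] z by simp
  then show "z = ?y"
    using c by (simp add: hsmult_hsmult one)
qed

text \<open>Left multiplication by \<open>t\<^bsup>l(u)\<^esup> (T\<^bsub>u\<^sup>-\<^sup>1\<^esub>)\<^sup>-\<^sup>1\<close>.\<close>
definition LU :: "nat \<Rightarrow> (nat \<Rightarrow> nat) \<Rightarrow> hecke \<Rightarrow> hecke" where
  "LU n u g = hmul n (hsmult (tt ^ len n u) (hinv n (Tb (inv u)))) g"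

text \<open>The power of \<open>tt\<close> in \<open>LU\<close> cancels the scalar of the inverse.
  Since any reduced word may be used, a word can be extended at either end, which gives
  \<open>LU_sw_comp\<close> and \<open>LU_comp_sw\<close>.\<close>

lemma LU_eq_foldr:
  assumes r: "redw n is u" and g: "g \<in> Hn n"
  shows "LU n u g = foldr (Lop n) is g"
proof -
  have s: "set is \<subseteq> {1..<n}" and l: "len n u = length is"
    using r by (simp_all add: redw_def)
  have "hsmult (tt ^ len n u) (hinv n (Tb (inv u))) = foldr (Lop n) is hone"
    using tt_pos by (simp add: hinv_Tb_inv [OF r] hsmult_hsmult l) (simp add: hsmult_def)
  then show ?thesis
    by (simp add: LU_def hmul_foldr_Lop [OF s] hmul_hone [OF g])
qed

lemma LU_id: "g \<in> Hn n \<Longrightarrow> LU n id g = g"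
  using LU_eq_foldr [of n "[]" id g] by (simp add: redw_def)

lemma LU_in_Hn: "u \<in> Sn n \<Longrightarrow> g \<in> Hn n \<Longrightarrow> LU n u g \<in> Hn n"
  using ex_redw [of u n] LU_eq_foldr foldr_Lop_in_Hn by metis

lemma LU_sw_comp:
  assumes u: "u \<in> Sn n" and i: "i \<in> {1..<n}" and less: "inv u i < inv u (Suc i)" and g: "g \<in> Hn n"
  shows "LU n (sw i \<circ> u) g = Lop n i (LU n u g)"
proof -
  obtain "is" where r: "redw n is u"
    using ex_redw [OF u] by blast
  then have "redw n (i # is) (sw i \<circ> u)"
    using i len_sw_comp [OF u i less] by (simp add: redw_def)
  then show ?thesis
    using LU_eq_foldr [OF r g] LU_eq_foldr [of n "i # is" "sw i \<circ> u" g] g by simp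
qed

lemma LU_comp_sw:
  assumes u: "u \<in> Sn n" and i: "i \<in> {1..<n}" and less: "u i < u (Suc i)" and g: "g \<in> Hn n"
  shows "LU n (u \<circ> sw i) g = LU n u (Lop n i g)"
proof -
  obtain "is" where r: "redw n is u"
    using ex_redw [OF u] by blast
  then have "redw n (is @ [i]) (u \<circ> sw i)"
    using i len_comp_sw [OF u i less] by (simp add: redw_def word_append)
  then show ?thesis
    using LU_eq_foldr [OF r Lop_in_Hn [OF g]] LU_eq_foldr [of n "is @ [i]" "u \<circ> sw i" g] g by simp
qed

subsection \<open>Columns and minimal coset representatives\<close>

lemma sorted_list_of_set_nth_less:
  "finite C \<Longrightarrow> i < j \<Longrightarrow> j < card C \<Longrightarrow> sorted_list_of_set C ! i < sorted_list_of_set C ! j"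
  using sorted_wrt_nth_less [OF strict_sorted_list_of_set, of i j C] by simp

lemma nth_image_shift:
  "length xs = m \<Longrightarrow> (\<lambda>k. xs ! (k - Suc c)) ` {Suc c..c + m} = set xs"
proof -
  assume m: "length xs = m"
  have "{Suc c..c + m} = (\<lambda>k. k + Suc c) ` {0..<m}"
    by (simp only: image_add_atLeastLessThan') (simp add: atLeastLessThanSuc_atLeastAtMost add.commute)
  then show ?thesis
    using m by (auto simp: image_image set_conv_nth)
qed

context
  fixes n :: nat and C :: "nat set"
  assumes C: "C \<subseteq> {1..n}"
begin

lemma card_col_le: "card C \<le> n"
  using card_mono [OF _ C] by simp

lemma finite_col: "finite C"
  using C finite_subset by blast

lemma ucol_mono:
  assumes "1 \<le> i" "i < j" "j \<le> n" "j \<le> card C \<or> card C < i"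
  shows "ucol n C i < ucol n C j"
proof (cases "j \<le> card C")
  case True
  then show ?thesis
    using assms finite_col by (auto simp: ucol_def entry_def intro!: sorted_list_of_set_nth_less)
next
  case False
  have "card ({1..n} - C) = n - card C"
    using card_Diff_subset [OF finite_col C] by simp
  then show ?thesis
    using assms False by (auto simp: ucol_def intro!: sorted_list_of_set_nth_less)
qed

lemma ucol_image: "ucol n C ` {1..card C} = C"
proof -
  have "ucol n C ` {1..card C} = (\<lambda>k. sorted_list_of_set C ! (k - Suc 0)) ` {Suc 0..0 + card C}"
    by (intro image_cong) (auto simp: ucol_def entry_def)
  also have "\<dots> = C"
    by (subst nth_image_shift) (simp_all add: finite_col)
  finally show ?thesis .
qed

lemma ucol_image_compl: "ucol n C ` {Suc (card C)..n} = {1..n} - C"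
proof -
  have m: "card ({1..n} - C) = n - card C"
    using card_Diff_subset [OF finite_col C] by simp
  have "ucol n C ` {Suc (card C)..n} =
      (\<lambda>k. sorted_list_of_set ({1..n} - C) ! (k - Suc (card C))) ` {Suc (card C)..card C + (n - card C)}"
    using card_col_le by (intro image_cong) (auto simp: ucol_def)
  also have "\<dots> = {1..n} - C"
    using m by (subst nth_image_shift) simp_all
  finally show ?thesis .
qed

lemma ucol_in_Sn: "ucol n C \<in> Sn n"
proof -
  have "{1..n} = {1..card C} \<union> {Suc (card C)..n}"
    using card_col_le by auto
  then have im: "ucol n C ` {1..n} = {1..n}"
    using ucol_image ucol_image_compl C by (simp add: image_Un) blast
  then have "bij_betw (ucol n C) {1..n} {1..n}"
    by (simp add: bij_betw_def eq_card_imp_inj_on)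
  then show ?thesis
    unfolding Sn_def using card_col_le by (auto intro!: bij_imp_permutes simp: ucol_def)
qed

lemma ucol_mem_iff: "k \<in> {1..n} \<Longrightarrow> ucol n C k \<in> C \<longleftrightarrow> k \<le> card C"
  using ucol_image ucol_image_compl by (cases "k \<le> card C") force+

lemma inv_ucol_le_iff: "j \<in> {1..n} \<Longrightarrow> inv (ucol n C) j \<le> card C \<longleftrightarrow> j \<in> C"
  using ucol_mem_iff [of "inv (ucol n C) j"] Sn_range [OF Sn_inv [OF ucol_in_Sn]]
  by (simp add: Sn_inv_eq [OF ucol_in_Sn])

text \<open>Monotonicity makes the two lists of values sorted, and the sorted enumerations of
  \<open>C\<close> and of its complement are unique.\<close>

lemma ucol_unique:
  assumes u: "u \<in> Sn n" and im: "u ` {1..card C} = C"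
    and mono: "\<And>i j. 1 \<le> i \<Longrightarrow> i < j \<Longrightarrow> j \<le> n \<Longrightarrow> j \<le> card C \<or> card C < i \<Longrightarrow> u i < u j"
  shows "ucol n C = u"
proof
  fix k
  have "sorted_list_of_set C = map u [1..<Suc (card C)]"
    using finite_col card_col_le im mono
    by (subst sorted_list_of_set_unique [symmetric])
      (auto simp: sorted_wrt_iff_nth_less simp flip: atLeastLessThanSuc_atLeastAtMost simp del: upt_Suc)
  moreover have "sorted_list_of_set ({1..n} - C) = map u [Suc (card C)..<Suc n]"
  proof (subst sorted_list_of_set_unique [symmetric])
    have "u ` {Suc (card C)..n} = u ` ({1..n} - {1..card C})"
      by (intro arg_cong [of _ _ "image u"]) auto
    also have "\<dots> = u ` {1..n} - u ` {1..card C}"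
      using Sn_bij [OF u] by (intro image_set_diff) (simp add: bij_def)
    also have "\<dots> = {1..n} - C"
      using u im by (simp add: Sn_def permutes_image)
    finally have "u ` {Suc (card C)..n} = {1..n} - C" .
    then show "sorted_wrt (<) (map u [Suc (card C)..<Suc n]) \<and>
        set (map u [Suc (card C)..<Suc n]) = {1..n} - C \<and>
        length (map u [Suc (card C)..<Suc n]) = card ({1..n} - C)"
      using card_Diff_subset [OF finite_col C] mono
      by (auto simp: sorted_wrt_iff_nth_less atLeastLessThanSuc_atLeastAtMost simp del: upt_Suc)
  qed simp
  ultimately show "ucol n C k = u k"
    using u by (auto simp: ucol_def entry_def Sn_def permutes_def simp del: upt_Suc)
qed

end

lemma ucol_initial: "a \<le> n \<Longrightarrow> ucol n {1..a} = id"
  by (rule ucol_unique) auto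

lemma scol_mem_iff: "x \<in> scol j C \<longleftrightarrow> sw j x \<in> C"
  by (force simp: scol_def image_iff)

lemma card_scol [simp]: "card (scol j C) = card C"
  using bij_sw [of j] by (auto simp: scol_def bij_def intro!: card_image intro: inj_on_subset)

lemma scol_subset: "C \<subseteq> {1..n} \<Longrightarrow> j \<in> {1..<n} \<Longrightarrow> scol j C \<subseteq> {1..n}"
  by (auto simp: scol_def sw_def)

lemma scol_scol [simp]: "scol j (scol j C) = C"
  by (auto simp: scol_mem_iff)

lemma scol_eq: "(j \<in> C \<longleftrightarrow> Suc j \<in> C) \<Longrightarrow> scol j C = C"
  by (auto simp: scol_mem_iff sw_def split: if_splits)

text \<open>Exactly one of \<open>j\<close>, \<open>Suc j\<close> lies in \<open>C\<close>, so the
  two values never occur in the same block, and \<open>sw j\<close> preserves the order inside each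
  block.\<close>

lemma ucol_scol:
  assumes C: "C \<subseteq> {1..n}" and j: "j \<in> {1..<n}" and neq: "(j \<in> C) \<noteq> (Suc j \<in> C)"
  shows "ucol n (scol j C) = sw j \<circ> ucol n C"
proof (rule ucol_unique [OF scol_subset [OF C j]])
  show "sw j \<circ> ucol n C \<in> Sn n"
    by (simp only: sw_comp_in_Sn_iff [OF j] ucol_in_Sn [OF C])
  show "(sw j \<circ> ucol n C) ` {1..card (scol j C)} = scol j C"
    by (simp only: image_comp [symmetric] card_scol ucol_image [OF C]) (simp add: scol_def)
  fix i k assume ik: "1 \<le> i" "i < k" "k \<le> n" "k \<le> card (scol j C) \<or> card (scol j C) < i"
  have "{ucol n C i, ucol n C k} \<noteq> {j, Suc j}"
    using ucol_mem_iff [OF C, of i] ucol_mem_iff [OF C, of k] ik neq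
    by (auto simp: doubleton_eq_iff)
  then show "(sw j \<circ> ucol n C) i < (sw j \<circ> ucol n C) k"
    using ucol_mono [OF C, of i k] ik by (simp add: sw_less_iff)
qed

text \<open>\<open>j\<close> and \<open>Suc j\<close> lie in one block, on which
  \<open>ucol n C\<close> increases, so their positions are adjacent. Hence
  \<open>sw j \<circ> ucol n C = ucol n C \<circ> sw k\<close> with \<open>sw k\<close> in the
  parabolic subgroup.\<close>

lemma ucol_fixed:
  assumes C: "C \<subseteq> {1..n}" and j: "j \<in> {1..<n}" and eq: "(j \<in> C) \<longleftrightarrow> (Suc j \<in> C)"
  obtains k where "k \<in> {1..<n}" "k \<noteq> card C" "ucol n C k = j" "ucol n C (Suc k) = Suc j"
proof -
  let ?u = "ucol n C"
  define k where "k = inv ?u j"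
  define m where "m = inv ?u (Suc j)"
  note uS = ucol_in_Sn [OF C]
  have u: "?u k = j" "?u m = Suc j"
    by (simp_all add: k_def m_def Sn_inv_eq [OF uS])
  have r: "k \<in> {1..n}" "m \<in> {1..n}"
    using Sn_range [OF uS, of k] Sn_range [OF uS, of m] j u by auto
  have b: "k \<le> card C \<longleftrightarrow> m \<le> card C"
    using inv_ucol_le_iff [OF C] j eq by (simp add: k_def m_def)
  have "k < m"
    using ucol_mono [OF C, of m k] r b u by (cases k m rule: linorder_cases) auto
  moreover have "m = Suc k"
  proof (rule ccontr)
    assume "m \<noteq> Suc k"
    with \<open>k < m\<close> have "Suc k < m" by simp
    then show False
      using ucol_mono [OF C, of k "Suc k"] ucol_mono [OF C, of "Suc k" m] r b u by auto
  qed
  ultimately show thesis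
    using that [of k] r b u by auto
qed

section \<open>Maximal parabolic subgroups and their cosets\<close>

lemma stab_varpi_iff:
  "w \<in> stab n (varpi b) \<longleftrightarrow> w \<in> Sn n \<and> (\<forall>k\<in>{1..n}. w k \<le> b \<longleftrightarrow> k \<le> b)"
proof -
  have "varpi b (w k) = varpi b k \<longleftrightarrow> (w k \<le> b \<longleftrightarrow> k \<le> b)" if "w \<in> Sn n" "k \<in> {1..n}" for k
    using that Sn_range [of w n k] by (auto simp: varpi_def)
  then show ?thesis by (auto simp: stab_def)
qed

lemma stab_varpi_image_iff:
  assumes "b \<le> n"
  shows "w \<in> stab n (varpi b) \<longleftrightarrow> w \<in> Sn n \<and> w ` {1..b} = {1..b}"
proof (cases "w \<in> Sn n")
  case w: True
  show ?thesis
  proof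
    assume s: "w \<in> stab n (varpi b)"
    have "w ` {1..b} \<subseteq> {1..b}"
      using s assms Sn_range [OF w] by (fastforce simp: stab_varpi_iff)
    moreover have "card (w ` {1..b}) = card {1..b}"
      using Sn_bij [OF w] by (intro card_image) (auto simp: bij_def intro: inj_on_subset)
    ultimately show "w \<in> Sn n \<and> w ` {1..b} = {1..b}"
      using w by (simp add: card_subset_eq)
  next
    assume im: "w \<in> Sn n \<and> w ` {1..b} = {1..b}"
    have "w k \<le> b \<longleftrightarrow> k \<le> b" if k: "k \<in> {1..n}" for k
    proof -
      have "w k \<in> w ` {1..b} \<longleftrightarrow> k \<in> {1..b}"
        using Sn_bij [OF w] by (simp add: bij_def inj_image_mem_iff)
      then show ?thesis
        using im k Sn_range [OF w, of k] by auto
    qed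
    then show "w \<in> stab n (varpi b)"
      using w by (simp add: stab_varpi_iff)
  qed
qed (simp add: stab_def)

lemma finite_stab [simp]: "finite (stab n lam)"
  by (simp add: stab_def)

lemma stab_in_Sn: "w \<in> stab n lam \<Longrightarrow> w \<in> Sn n"
  by (simp add: stab_def)

lemma stab_varpi_comp:
  "u \<in> stab n (varpi b) \<Longrightarrow> w \<in> stab n (varpi b) \<Longrightarrow> u \<circ> w \<in> stab n (varpi b)"
  unfolding stab_varpi_iff using Sn_range [of w n] by (simp add: Sn_comp)

lemma stab_varpi_inv:
  assumes "w \<in> stab n (varpi b)" shows "inv w \<in> stab n (varpi b)"
proof -
  have w: "w \<in> Sn n" using assms stab_in_Sn by blast
  have "inv w k \<le> b \<longleftrightarrow> k \<le> b" if "k \<in> {1..n}" for k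
    using assms Sn_range [OF Sn_inv [OF w], of k] that Sn_inv_eq(2) [OF w, of k]
    unfolding stab_varpi_iff by metis
  then show ?thesis by (simp add: stab_varpi_iff Sn_inv [OF w])
qed

lemma sw_in_stab_varpi: "k \<in> {1..<n} \<Longrightarrow> k \<noteq> b \<Longrightarrow> sw k \<in> stab n (varpi b)"
  using sw_in_Sn [of k n] by (auto simp: stab_varpi_iff sw_def)

text \<open>An inversion of \<open>w\<close> involves two values of the same block, where
  \<open>ucol n C\<close> increases.\<close>

lemma len_ucol_comp:
  assumes C: "C \<subseteq> {1..n}" and w: "w \<in> stab n (varpi (card C))"
  shows "len n (ucol n C \<circ> w) = len n (ucol n C) + len n w"
proof (rule len_comp [OF ucol_in_Sn [OF C] stab_in_Sn [OF w]])
  fix i j assume ij: "1 \<le> i" "i < j" "j \<le> n" "w j < w i"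
  have r: "w i \<in> {1..n}" "w j \<in> {1..n}"
    using Sn_range [OF stab_in_Sn [OF w], of i] Sn_range [OF stab_in_Sn [OF w], of j] ij by auto
  have "w i \<le> card C \<longleftrightarrow> i \<le> card C" "w j \<le> card C \<longleftrightarrow> j \<le> card C"
    using bspec [OF conjunct2 [OF w [unfolded stab_varpi_iff]], of i]
      bspec [OF conjunct2 [OF w [unfolded stab_varpi_iff]], of j] ij by auto
  then show "ucol n C (w j) < ucol n C (w i)"
    using ij r by (intro ucol_mono [OF C]) auto
qed

lemma finite_cols [simp]: "finite (cols n l)"
  by (rule finite_subset [of _ "Pow {1..n}"]) (auto simp: cols_def)

lemma Hpar_outside: "h \<in> Hpar n lam \<Longrightarrow> w \<notin> stab n lam \<Longrightarrow> h w = 0"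
  by (auto simp: Hpar_def)

lemma HparI: "(\<And>w. w \<notin> stab n lam \<Longrightarrow> h w = 0) \<Longrightarrow> h \<in> Hpar n lam"
  unfolding Hpar_def Hn_def using stab_in_Sn by blast

lemma Hpar_Hn: "h \<in> Hpar n lam \<Longrightarrow> h \<in> Hn n"
  by (simp add: Hpar_def)

text \<open>Lengths add for minimal coset representatives, so multiplying by
  \<open>Tb (ucol n F)\<close> merely translates coefficients.\<close>

lemma hmul_Tb_ucol:
  assumes F: "F \<in> cols n l" and f: "f \<in> Hpar n (varpi l)"
  shows "hmul n (Tb (ucol n F)) f v = f (inv (ucol n F) \<circ> v)"
proof -
  let ?u = "ucol n F"
  have F': "F \<subseteq> {1..n}" and l: "card F = l" using F by (auto simp: cols_def)
  have u: "?u \<in> Sn n" by (rule ucol_in_Sn [OF F'])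
  have "hmul n (Tb ?u) f v = (\<Sum>w\<in>Sn n. f w * Tb (?u \<circ> w) v)"
    unfolding hmul_def
  proof (intro sum.cong refl)
    fix w assume w: "w \<in> Sn n"
    show "f w * rmulT n w (Tb ?u) v = f w * Tb (?u \<circ> w) v"
    proof (cases "w \<in> stab n (varpi l)")
      case True
      then show ?thesis
        using rmulT_Tb [OF u w] len_ucol_comp [OF F', of w] l by simp
    qed (simp add: Hpar_outside [OF f])
  qed
  also have "\<dots> = (\<Sum>w\<in>Sn n. if inv ?u \<circ> v = w then f w else 0)"
  proof (intro sum.cong refl)
    fix w
    have "v = ?u \<circ> w \<longleftrightarrow> inv ?u \<circ> v = w"
      by (auto simp: Sn_inv_comp [OF u] simp flip: comp_assoc)
    then show "f w * Tb (?u \<circ> w) v = (if inv ?u \<circ> v = w then f w else 0)"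
      by (simp add: Tb_def)
  qed
  also have "\<dots> = f (inv ?u \<circ> v)"
    using Hn_outside [OF Hpar_Hn [OF f]] by auto
  finally show ?thesis .
qed

text \<open>The coset of a permutation is read off from its image of \<open>{1..l}\<close>, and
  distinct columns give distinct images; all terms but one vanish.\<close>

lemma sum_cols_coset:
  assumes f: "\<And>F. F \<in> cols n l \<Longrightarrow> f F \<in> Hpar n (varpi l)"
    and F: "F \<in> cols n l" and w: "w \<in> stab n (varpi l)"
  shows "(\<Sum>F'\<in>cols n l. f F' (inv (ucol n F') \<circ> (ucol n F \<circ> w))) = f F w"
proof -
  have im: "ucol n F' ` {1..l} = F'" and l: "l \<le> n" and u: "ucol n F' \<in> Sn n"
    if "F' \<in> cols n l" for F'
    using that ucol_image [of F' n] card_col_le [of F' n] ucol_in_Sn [of F' n]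
    by (auto simp: cols_def)
  have "f F' (inv (ucol n F') \<circ> (ucol n F \<circ> w)) = (if F' = F then f F w else 0)"
    if F': "F' \<in> cols n l" for F'
  proof (cases "F' = F")
    case True
    then show ?thesis by (simp add: Sn_inv_comp [OF u [OF F]] flip: comp_assoc)
  next
    case False
    have "inv (ucol n F') \<circ> (ucol n F \<circ> w) \<notin> stab n (varpi l)"
    proof
      assume "inv (ucol n F') \<circ> (ucol n F \<circ> w) \<in> stab n (varpi l)"
      then have "ucol n F' ` ((inv (ucol n F') \<circ> (ucol n F \<circ> w)) ` {1..l}) = F'"
        using im [OF F'] l [OF F'] by (simp only: stab_varpi_image_iff)
      moreover have "ucol n F' ` ((inv (ucol n F') \<circ> (ucol n F \<circ> w)) ` {1..l}) = ucol n F ` (w ` {1..l})"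
        by (simp add: image_image Sn_inv_eq [OF u [OF F']])
      moreover have "w ` {1..l} = {1..l}"
        using w l [OF F] by (simp add: stab_varpi_image_iff)
      ultimately show False using False im [OF F] by simp
    qed
    then show ?thesis
      using False by (simp add: Hpar_outside [OF f [OF F']])
  qed
  then have "(\<Sum>F'\<in>cols n l. f F' (inv (ucol n F') \<circ> (ucol n F \<circ> w)))
      = (\<Sum>F'\<in>cols n l. if F' = F then f F w else 0)"
    by (intro sum.cong refl)
  then show ?thesis using F by simp
qed

text \<open>Makes the definite description explicit: the component at \<open>F\<close> is
  \<open>h\<close> restricted to the left coset of \<open>ucol n F\<close>, and these cosets
  partition \<open>Sn n\<close>.\<close>

lemma decomp_eq:
  assumes h: "h \<in> Hn n" and F: "F \<in> cols n l"
  shows "decomp n l h F = (\<lambda>w. if w \<in> stab n (varpi l) then h (ucol n F \<circ> w) else 0)"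
proof -
  define f0 where "f0 F = (if F \<in> cols n l
    then (\<lambda>w. if w \<in> stab n (varpi l) then h (ucol n F \<circ> w) else 0) else (\<lambda>_. 0))" for F
  have l: "l \<le> n"
    using F card_col_le by (auto simp: cols_def)
  have f0: "f0 F \<in> Hpar n (varpi l)" for F
    by (rule HparI) (simp add: f0_def)
  have "decomp n l h = f0"
    unfolding decomp_def
  proof (rule the_equality)
    have eq: "h v = (\<Sum>F\<in>cols n l. hmul n (Tb (ucol n F)) (f0 F) v)" for v
    proof (cases "v \<in> Sn n")
      case v: True
      define F where "F = v ` {1..l}"
      define w where "w = inv (ucol n F) \<circ> v"
      have "card F = l"
        unfolding F_def using Sn_bij [OF v] by (subst card_image) (auto simp: bij_def intro: inj_on_subset)
      moreover have "F \<subseteq> {1..n}"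
        using Sn_range [OF v] l by (fastforce simp: F_def)
      ultimately have F: "F \<in> cols n l" by (simp add: cols_def)
      have u: "ucol n F \<in> Sn n" and im: "ucol n F ` {1..l} = F"
        using F ucol_in_Sn [of F n] ucol_image [of F n] by (auto simp: cols_def)
      have "w ` {1..l} = inv (ucol n F) ` (ucol n F ` {1..l})"
        unfolding w_def image_comp [symmetric] im F_def [symmetric] ..
      also have "\<dots> = {1..l}"
        by (simp add: image_image Sn_inv_eq [OF u])
      finally have w: "w \<in> stab n (varpi l)"
        unfolding stab_varpi_image_iff [OF l] w_def using Sn_comp [OF Sn_inv [OF u] v] by blast
      have vw: "ucol n F \<circ> w = v"
        by (simp add: w_def Sn_inv_comp [OF u] flip: comp_assoc)
      have "h v = f0 F w"
        using F w by (simp add: f0_def vw)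
      also have "\<dots> = (\<Sum>F'\<in>cols n l. f0 F' (inv (ucol n F') \<circ> v))"
        using sum_cols_coset [OF f0 F w] by (simp only: vw)
      also have "\<dots> = (\<Sum>F'\<in>cols n l. hmul n (Tb (ucol n F')) (f0 F') v)"
        by (rule sum.cong [OF refl]) (rule hmul_Tb_ucol [symmetric, OF _ f0])
      finally show ?thesis .
    next
      case False
      have "f0 F (inv (ucol n F) \<circ> v) = 0" if F: "F \<in> cols n l" for F
      proof (rule Hpar_outside [OF f0], rule notI)
        have u: "ucol n F \<in> Sn n"
          using F ucol_in_Sn [of F n] by (simp add: cols_def)
        assume "inv (ucol n F) \<circ> v \<in> stab n (varpi l)"
        then have "ucol n F \<circ> (inv (ucol n F) \<circ> v) \<in> Sn n"
          by (intro Sn_comp u stab_in_Sn)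
        moreover have "ucol n F \<circ> (inv (ucol n F) \<circ> v) = v"
          by (simp add: Sn_inv_comp(2) [OF u] flip: comp_assoc)
        ultimately show False using False by simp
      qed
      then show ?thesis
        using Hn_outside [OF h False] by (simp add: hmul_Tb_ucol [OF _ f0])
    qed
    have "\<forall>F. F \<notin> cols n l \<longrightarrow> f0 F = (\<lambda>_. 0)"
      by (simp add: f0_def)
    then show "(\<forall>F. F \<notin> cols n l \<longrightarrow> f0 F = (\<lambda>_. 0)) \<and> (\<forall>F\<in>cols n l. f0 F \<in> Hpar n (varpi l)) \<and>
        h = (\<lambda>v. \<Sum>F\<in>cols n l. hmul n (Tb (ucol n F)) (f0 F) v)"
      using f0 eq by blast
  next
    fix f
    assume f: "(\<forall>F. F \<notin> cols n l \<longrightarrow> f F = (\<lambda>_. 0)) \<and> (\<forall>F\<in>cols n l. f F \<in> Hpar n (varpi l)) \<and>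
        h = (\<lambda>v. \<Sum>F\<in>cols n l. hmul n (Tb (ucol n F)) (f F) v)"
    then have f_Hpar: "f F \<in> Hpar n (varpi l)" if "F \<in> cols n l" for F
      using that by blast
    have f_zero: "f F = (\<lambda>_. 0)" if "F \<notin> cols n l" for F
      using f that by blast
    have hf: "h v = (\<Sum>F\<in>cols n l. hmul n (Tb (ucol n F)) (f F) v)" for v
      using f by meson
    show "f = f0"
    proof (intro ext)
      fix F w
      show "f F w = f0 F w"
      proof (cases "F \<in> cols n l \<and> w \<in> stab n (varpi l)")
        case True
        have "h (ucol n F \<circ> w) = (\<Sum>F'\<in>cols n l. f F' (inv (ucol n F') \<circ> (ucol n F \<circ> w)))"
          unfolding hf by (rule sum.cong [OF refl]) (rule hmul_Tb_ucol [OF _ f_Hpar])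
        also have "\<dots> = f F w"
          using True by (intro sum_cols_coset f_Hpar) auto
        finally show ?thesis using True by (simp add: f0_def)
      next
        case False
        then show ?thesis
          using f_zero [of F] Hpar_outside [OF f_Hpar, of F w] by (auto simp: f0_def)
      qed
    qed
  qed
  then show ?thesis using F by (simp add: f0_def)
qed

subsection \<open>The trivial character and the induced module\<close>

definition eps :: "nat \<Rightarrow> hecke \<Rightarrow> coef" where
  "eps n h = (\<Sum>w\<in>Sn n. h w * tt ^ len n w)"

text \<open>The trivial character of the component \<open>h\<^sub>C\<close> in \<open>h = \<Sum>\<^sub>F T\<^bsub>u\<^sub>F\<^esub> h\<^sub>F\<close>.\<close>
definition ctr :: "nat \<Rightarrow> hecke \<Rightarrow> nat set \<Rightarrow> coef" where
  "ctr n h C = (\<Sum>w\<in>stab n (varpi (card C)). h (ucol n C \<circ> w) * tt ^ len n w)"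

text \<open>The action of \<open>t T\<^sub>j\<^sup>-\<^sup>1\<close> on the module induced from the trivial character of a maximal
  parabolic subalgebra, whose basis is indexed by columns.\<close>
definition ell :: "nat \<Rightarrow> (nat set \<Rightarrow> coef) \<Rightarrow> nat set \<Rightarrow> coef" where
  "ell j g C = (if Suc j \<in> C \<and> j \<notin> C then g (scol j C)
     else if j \<in> C \<and> Suc j \<notin> C then tt * g (scol j C) + (1 - tt) * g C
     else g C)"

text \<open>On a pair \<open>w\<close>, \<open>sw k \<circ> w\<close> with \<open>w\<close> shorter,
  old values \<open>y\<close>, \<open>y'\<close> and weights \<open>q\<close>,
  \<open>tt * q\<close>, the new values are \<open>tt * y' + (1 - tt) * y\<close> and
  \<open>y\<close>; the weighted sum is unchanged. A general closed \<open>X\<close> serves both the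
  whole group and a parabolic subgroup.\<close>

lemma sum_Lop:
  assumes k: "k \<in> {1..<n}" and X: "X \<subseteq> Sn n" and closed: "\<And>w. w \<in> X \<Longrightarrow> sw k \<circ> w \<in> X"
  shows "(\<Sum>w\<in>X. Lop n k y w * tt ^ len n w) = (\<Sum>w\<in>X. y w * tt ^ len n w)"
proof -
  define U where "U = {w \<in> X. inv w k < inv w (Suc k)}"
  have fin: "finite X" using finite_subset [OF X] by simp
  have split: "sum f X = (\<Sum>w\<in>U. f w + f (sw k \<circ> w))" for f :: hecke
  proof -
    have "sum f (X - U) = (\<Sum>w\<in>U. f (sw k \<circ> w))"
    proof (rule sum.reindex_bij_witness [of _ "\<lambda>w. sw k \<circ> w" "\<lambda>w. sw k \<circ> w"])
      fix w assume w: "w \<in> X - U"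
      then have wS: "w \<in> Sn n" using X by blast
      have "inv w (Suc k) < inv w k"
        using w inv_i_neq [OF wS, of k] by (auto simp: U_def)
      then show "sw k \<circ> w \<in> U"
        using w closed by (simp add: U_def inv_sw_comp [OF wS k])
    next
      fix w assume w: "w \<in> U"
      then have wS: "w \<in> Sn n" using X by (auto simp: U_def)
      show "sw k \<circ> w \<in> X - U"
        using w closed by (simp add: U_def inv_sw_comp [OF wS k])
    qed simp_all
    then have "sum f X = sum f U + (\<Sum>w\<in>U. f (sw k \<circ> w))"
      using fin sum.subset_diff [of U X f] by (simp add: U_def add.commute)
    then show ?thesis by (simp add: sum.distrib)
  qed
  have "Lop n k y w * tt ^ len n w + Lop n k y (sw k \<circ> w) * tt ^ len n (sw k \<circ> w)
      = y w * tt ^ len n w + y (sw k \<circ> w) * tt ^ len n (sw k \<circ> w)" if "w \<in> U" for w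
  proof -
    have w: "w \<in> Sn n" and less: "inv w k < inv w (Suc k)"
      using that X by (auto simp: U_def)
    have sw: "sw k \<circ> w \<in> Sn n"
      using w by (simp only: sw_comp_in_Sn_iff [OF k])
    show ?thesis
      using less len_sw_comp [OF w k less]
      by (simp add: Lop_apply [OF w] Lop_apply [OF sw] inv_sw_comp [OF w k] algebra_simps)
  qed
  then show ?thesis
    unfolding split by (intro sum.cong refl)
qed

lemma eps_Lop: "i \<in> {1..<n} \<Longrightarrow> eps n (Lop n i h) = eps n h"
  unfolding eps_def using sw_comp_in_Sn_iff [of i n] by (intro sum_Lop) auto

lemma eps_LU:
  assumes u: "u \<in> Sn n" and g: "g \<in> Hn n"
  shows "eps n (LU n u g) = eps n g"
proof -
  obtain "is" where r: "redw n is u"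
    using ex_redw [OF u] by blast
  have "set is \<subseteq> {1..<n} \<Longrightarrow> eps n (foldr (Lop n) is g) = eps n g"
    by (induction "is") (simp_all add: eps_Lop)
  then show ?thesis
    using r LU_eq_foldr [OF r g] by (simp add: redw_def)
qed

text \<open>If exactly one of \<open>j\<close>, \<open>Suc j\<close> lies in \<open>C\<close>, the
  descent test for \<open>ucol n C \<circ> w\<close> does not depend on \<open>w\<close>, and whole
  cosets are exchanged. Otherwise \<open>sw j\<close> becomes some \<open>sw k\<close> inside the
  parabolic subgroup, and the trivial character absorbs it.\<close>

lemma ctr_Lop:
  assumes C: "C \<subseteq> {1..n}" and j: "j \<in> {1..<n}"
  shows "ctr n (Lop n j x) C = ell j (ctr n x) C"
proof -
  let ?u = "ucol n C"
  let ?X = "stab n (varpi (card C))"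
  note u = ucol_in_Sn [OF C]
  have uw: "?u \<circ> w \<in> Sn n" if "w \<in> ?X" for w
    using Sn_comp [OF u stab_in_Sn [OF that]] .
  have inv: "inv (?u \<circ> w) k = inv w (inv ?u k)" if "w \<in> ?X" for w k
    using inv_comp_Sn [OF u stab_in_Sn [OF that]] by simp
  have block: "inv (?u \<circ> w) k \<le> card C \<longleftrightarrow> k \<in> C" if w: "w \<in> ?X" and k: "k \<in> {1..n}" for w k
  proof -
    have "inv ?u k \<in> {1..n}"
      using Sn_range [OF Sn_inv [OF u], of k] k by simp
    then have "inv w (inv ?u k) \<le> card C \<longleftrightarrow> inv ?u k \<le> card C"
      using stab_varpi_inv [OF w] by (simp add: stab_varpi_iff)
    then show ?thesis
      using inv_ucol_le_iff [OF C k] by (simp add: inv [OF w])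
  qed
  have jn: "j \<in> {1..n}" "Suc j \<in> {1..n}" using j by auto
  consider (down) "Suc j \<in> C" "j \<notin> C" | (up) "j \<in> C" "Suc j \<notin> C" | (both) "j \<in> C \<longleftrightarrow> Suc j \<in> C"
    by blast
  then show ?thesis
  proof cases
    case down
    have us: "ucol n (scol j C) = sw j \<circ> ?u"
      by (rule ucol_scol [OF C j]) (use down in blast)
    have "Lop n j x (?u \<circ> w) = x (sw j \<circ> ?u \<circ> w)" if "w \<in> ?X" for w
      using block [OF that jn(1)] block [OF that jn(2)] down
      by (simp add: Lop_apply [OF uw [OF that]] comp_assoc)
    then show ?thesis
      using down by (simp add: ctr_def ell_def us)
  next
    case up
    have us: "ucol n (scol j C) = sw j \<circ> ?u"
      by (rule ucol_scol [OF C j]) (use up in blast)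
    have "Lop n j x (?u \<circ> w) = tt * x (sw j \<circ> ?u \<circ> w) + (1 - tt) * x (?u \<circ> w)" if "w \<in> ?X" for w
      using block [OF that jn(1)] block [OF that jn(2)] up
      by (simp add: Lop_apply [OF uw [OF that]] comp_assoc)
    then have "ctr n (Lop n j x) C = (\<Sum>w\<in>?X. (tt * x (sw j \<circ> ?u \<circ> w) + (1 - tt) * x (?u \<circ> w)) * tt ^ len n w)"
      unfolding ctr_def by (intro sum.cong refl) simp
    also have "\<dots> = tt * ctr n x (scol j C) + (1 - tt) * ctr n x C"
      by (simp add: ctr_def us sum_distrib_left distrib_right sum.distrib mult.assoc)
    finally show ?thesis
      using up by (simp add: ell_def)
  next
    case both
    obtain k where k: "k \<in> {1..<n}" "k \<noteq> card C" "?u k = j" "?u (Suc k) = Suc j"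
      using ucol_fixed [OF C j both] by blast
    have swu: "sw j \<circ> ?u = ?u \<circ> sw k"
      by (rule sw_comp_eq_comp_sw [OF u]) (simp add: k)
    have iu: "inv ?u j = k" "inv ?u (Suc j) = Suc k"
      using k Sn_inv_eq(1) [OF u] by metis+
    have "Lop n j x (?u \<circ> w) = Lop n k (\<lambda>w. x (?u \<circ> w)) w" if "w \<in> ?X" for w
    proof -
      have "sw j \<circ> (?u \<circ> w) = ?u \<circ> (sw k \<circ> w)"
        by (simp only: comp_assoc [symmetric] swu)
      then show ?thesis
        by (simp add: Lop_apply [OF uw [OF that]] Lop_apply [OF stab_in_Sn [OF that]] inv [OF that] iu)
    qed
    then have "ctr n (Lop n j x) C = (\<Sum>w\<in>?X. Lop n k (\<lambda>w. x (?u \<circ> w)) w * tt ^ len n w)"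
      unfolding ctr_def by (intro sum.cong refl) simp
    also have "\<dots> = ctr n x C"
      unfolding ctr_def using stab_varpi_comp [OF sw_in_stab_varpi [OF k(1,2)]] stab_in_Sn
      by (intro sum_Lop [OF k(1)]) blast+
    finally show ?thesis
      using both by (auto simp: ell_def)
  qed
qed

section \<open>Induction over columns and right invariance\<close>

lemma scol_up: "j \<in> C \<Longrightarrow> Suc j \<notin> C \<Longrightarrow> scol j C = insert (Suc j) (C - {j})"
  by (auto simp: scol_mem_iff sw_def split: if_splits)

lemma sum_scol_up:
  "finite C \<Longrightarrow> j \<in> C \<Longrightarrow> Suc j \<notin> C \<Longrightarrow> \<Sum>(scol j C) = Suc (\<Sum>C)"
  by (simp add: scol_up sum.remove [of C j])

text \<open>Induction on the sum of the entries: a column without a gap \<open>j \<notin> C\<close>,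
  \<open>Suc j \<in> C\<close> is an initial segment, and moving an entry down into a gap lowers the
  sum by one.\<close>

lemma col_induct [consumes 2, case_names base step]:
  assumes "C \<subseteq> {1..n}" "card C = a" and base: "P {1..a}"
    and step: "\<And>C j. C \<subseteq> {1..n} \<Longrightarrow> card C = a \<Longrightarrow> j \<in> {1..<n} \<Longrightarrow> j \<in> C \<Longrightarrow> Suc j \<notin> C \<Longrightarrow>
      P C \<Longrightarrow> P (scol j C)"
  shows "P C"
  using assms(1,2)
proof (induction "\<Sum>C" arbitrary: C rule: less_induct)
  case less
  show ?case
  proof (cases "\<exists>j. 1 \<le> j \<and> Suc j \<in> C \<and> j \<notin> C")
    case True
    then obtain j where j: "1 \<le> j" "Suc j \<in> C" "j \<notin> C" by blast
    let ?D = "scol j C"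
    have jn: "j \<in> {1..<n}" using j less.prems(1) by auto
    have D: "?D \<subseteq> {1..n}" by (rule scol_subset [OF less.prems(1) jn])
    have mem: "j \<in> ?D" "Suc j \<notin> ?D"
      using j by (simp_all add: scol_mem_iff)
    have "\<Sum>?D < \<Sum>C"
      using sum_scol_up [OF finite_subset [OF D] mem] by simp
    then have "P ?D"
      using less D by simp
    then have "P (scol j ?D)"
      using step [of ?D j] D less.prems(2) jn mem by simp
    then show ?thesis by simp
  next
    case False
    have "C = {1..a}"
    proof (cases "C = {}")
      case True
      then show ?thesis using less.prems by auto
    next
      case ne: False
      have fin: "finite C" using less.prems finite_subset by blast
      have "y \<in> C" if "1 \<le> y" "y \<le> Max C" for y
        using that(2,1)
      proof (induction rule: inc_induct)
        case base
        then show ?case using ne fin by simp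
      next
        case (step y)
        then show ?case using False by auto
      qed
      then have "C = {1..Max C}"
        using fin less.prems(1) by (auto intro: Max_ge)
      then show ?thesis
        using less.prems(2) by (metis card_atLeastAtMost diff_Suc_1)
    qed
    then show ?thesis using base by simp
  qed
qed

text \<open>For \<open>h\<close> in the algebra this is the condition \<open>h T_i = t h\<close> for
  \<open>a < i < n\<close>, expressed through coefficients.\<close>

definition rinv :: "nat \<Rightarrow> nat \<Rightarrow> hecke \<Rightarrow> bool" where
  "rinv n a h \<longleftrightarrow> (\<forall>v\<in>Sn n. \<forall>z. z permutes {Suc a..n} \<longrightarrow> h (v \<circ> z) = h v)"

lemma permutes_in_Sn:
  "z permutes {Suc a..n} \<Longrightarrow> z \<in> Sn n" "a \<le> n \<Longrightarrow> y permutes {1..a} \<Longrightarrow> y \<in> Sn n"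
  unfolding Sn_def by (auto elim: permutes_subset)

text \<open>Let \<open>p\<close>, \<open>q\<close> be the positions of \<open>i\<close>,
  \<open>Suc i\<close> in \<open>v\<close>. If both exceed \<open>a\<close>, then
  \<open>sw i \<circ> v\<close> is \<open>v\<close> times a transposition of the last block, and
  \<open>Lop\<close> does not change the value. Otherwise \<open>inv z\<close> preserves the order
  of \<open>p\<close> and \<open>q\<close>, so \<open>v\<close> and \<open>v \<circ> z\<close> fall
  into the same branch.\<close>

lemma rinv_Lop:
  assumes h: "rinv n a h" and i: "i \<in> {1..<n}"
  shows "rinv n a (Lop n i h)"
  unfolding rinv_def
proof (intro ballI allI impI)
  fix v z assume v: "v \<in> Sn n" and z: "z permutes {Suc a..n}"
  let ?p = "inv v i" and ?q = "inv v (Suc i)"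
  have zS: "z \<in> Sn n" using z permutes_in_Sn by blast
  have vz: "v \<circ> z \<in> Sn n" by (rule Sn_comp [OF v zS])
  have sv: "sw i \<circ> v \<in> Sn n"
    using v by (simp only: sw_comp_in_Sn_iff [OF i])
  have h1: "h (v \<circ> z) = h v" and h2: "h (sw i \<circ> (v \<circ> z)) = h (sw i \<circ> v)"
    using h v sv z by (simp_all add: rinv_def flip: comp_assoc)
  have inv: "inv (v \<circ> z) k = inv z (inv v k)" for k
    using inv_comp_Sn [OF v zS] by simp
  show "Lop n i h (v \<circ> z) = Lop n i h v"
  proof (cases "a < ?p \<and> a < ?q")
    case True
    have pq: "?p \<in> {Suc a..n}" "?q \<in> {Suc a..n}"
      using True Sn_range [OF Sn_inv [OF v], of i] Sn_range [OF Sn_inv [OF v], of "Suc i"] i by auto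
    have "sw i \<circ> v = v \<circ> transpose ?p ?q"
    proof
      fix k
      show "(sw i \<circ> v) k = (v \<circ> transpose ?p ?q) k"
        using Sn_eq_iff [OF v, of k ?p] Sn_eq_iff [OF v, of k ?q]
        by (auto simp: sw_def transpose_def Sn_inv_eq [OF v])
    qed
    then have "h (sw i \<circ> v) = h v"
      using h v permutes_swap_id [OF pq] by (simp add: rinv_def)
    then show ?thesis
      unfolding Lop_apply [OF v] Lop_apply [OF vz] h1 h2 by (simp add: algebra_simps)
  next
    case False
    have zi: "inv z permutes {Suc a..n}" by (rule permutes_inv [OF z])
    have low: "inv z k = k" if "k \<le> a" for k
      using permutes_not_in [OF zi, of k] that by simp
    have high: "a < inv z k" if "a < k" for k
      using permutes_in_image [OF zi, of k] permutes_not_in [OF zi, of k] that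
      by (cases "k \<in> {Suc a..n}") auto
    have "inv z ?q < inv z ?p \<longleftrightarrow> ?q < ?p"
      using False low [of ?p] low [of ?q] high [of ?p] high [of ?q]
      by (cases "?p \<le> a"; cases "?q \<le> a") auto
    then show ?thesis
      unfolding Lop_apply [OF v] Lop_apply [OF vz] h1 h2 inv by simp
  qed
qed

lemma rinv_LU:
  assumes u: "u \<in> Sn n" and g: "g \<in> Hn n" and inv: "rinv n a g"
  shows "rinv n a (LU n u g)"
proof -
  obtain "is" where r: "redw n is u"
    using ex_redw [OF u] by blast
  have "set is \<subseteq> {1..<n} \<Longrightarrow> rinv n a (foldr (Lop n) is g)"
    by (induction "is") (simp_all add: rinv_Lop inv)
  then show ?thesis
    using r LU_eq_foldr [OF r g] by (simp add: redw_def)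
qed

section \<open>Block factorisation of stabilisers\<close>

lemma block_permutes:
  assumes "y permutes {1..a}" "z permutes {Suc a..n}"
  shows "k \<le> a \<Longrightarrow> z k = k" "k \<le> a \<Longrightarrow> y k \<le> a" "a < k \<Longrightarrow> y k = k" "a < k \<Longrightarrow> a < z k"
proof -
  show "k \<le> a \<Longrightarrow> z k = k" "a < k \<Longrightarrow> y k = k"
    using permutes_not_in [OF assms(1), of k] permutes_not_in [OF assms(2), of k] by auto
  show "k \<le> a \<Longrightarrow> y k \<le> a"
    using permutes_not_in [OF assms(1), of k] permutes_in_image [OF assms(1), of k]
    by (cases "k = 0") auto
  show "a < k \<Longrightarrow> a < z k"
    using permutes_not_in [OF assms(2), of k] permutes_in_image [OF assms(2), of k]
    by (cases "k \<le> n") auto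
qed

lemma block_commute:
  assumes "y permutes {1..a}" "z permutes {Suc a..n}"
  shows "z \<circ> y = y \<circ> z"
proof
  fix k
  show "(z \<circ> y) k = (y \<circ> z) k"
    using block_permutes [OF assms, of k] block_permutes(1) [OF assms, of "y k"]
      block_permutes(3) [OF assms, of "z k"] by (cases "k \<le> a") auto
qed

text \<open>All inversions of \<open>z\<close> lie above \<open>a\<close>, where \<open>y\<close> is
  the identity.\<close>

lemma len_block:
  assumes "a \<le> n" and y: "y permutes {1..a}" and z: "z permutes {Suc a..n}"
  shows "len n (y \<circ> z) = len n y + len n z"
proof (rule len_comp [OF permutes_in_Sn(2) [OF \<open>a \<le> n\<close> y] permutes_in_Sn(1) [OF z]])
  fix i j assume ij: "1 \<le> i" "i < j" "j \<le> n" "z j < z i"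
  note b = block_permutes [OF y z]
  have "a < j"
    using b(1) [of i] b(1) [of j] ij by linarith
  then have "a < z j" using b(4) by blast
  then show "y (z j) < y (z i)"
    using ij b(3) [of "z j"] b(3) [of "z i"] by simp
qed

lemma block_inj: "inj_on (\<lambda>(y, z). y \<circ> z) ({y. y permutes {1..a}} \<times> {z. z permutes {Suc a..n}})"
proof (rule inj_onI, clarsimp)
  fix y z y' z'
  assume p: "y permutes {Suc 0..a}" "z permutes {Suc a..n}" "y' permutes {Suc 0..a}" "z' permutes {Suc a..n}"
    and eq: "y \<circ> z = y' \<circ> z'"
  have "y k = y' k" for k
    using block_permutes(1,3) [of y a z n k] block_permutes(1,3) [of y' a z' n k] p fun_cong [OF eq, of k]
    by (cases "k \<le> a") auto
  then have "y = y'" by blast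
  then show "y = y' \<and> z = z'"
    using eq permutes_bij [OF p(3)] by (auto simp: fun_eq_iff bij_def inj_eq)
qed

lemma block_split:
  assumes a: "a \<le> n" and w: "w \<in> stab n (varpi a)"
  obtains y z where "y permutes {1..a}" "z permutes {Suc a..n}" "w = y \<circ> z"
proof -
  define y where "y k = (if k \<in> {1..a} then w k else k)" for k
  have wS: "w \<in> Sn n" and im: "w ` {1..a} = {1..a}"
    using w by (simp_all add: stab_varpi_image_iff [OF a])
  have "bij_betw w {1..a} {1..a}"
    using im Sn_bij [OF wS] by (auto simp: bij_betw_def bij_def intro: inj_on_subset)
  then have "bij_betw y {1..a} {1..a}"
    by (rule bij_betw_cong [THEN iffD1, rotated]) (simp add: y_def)
  then have y: "y permutes {1..a}"
    by (rule bij_imp_permutes) (auto simp: y_def)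
  note yS = permutes_in_Sn(2) [OF a y]
  define z where "z = inv y \<circ> w"
  have "z k = k" if "k \<in> {1..a}" for k
  proof -
    have "w k = y k" using that by (simp add: y_def)
    then show ?thesis by (simp add: z_def Sn_inv_eq [OF yS])
  qed
  moreover have "z permutes {1..n}"
    using Sn_comp [OF Sn_inv [OF yS] wS] by (simp add: z_def Sn_def)
  ultimately have "z permutes {Suc a..n}"
    by (elim permutes_superset) auto
  moreover have "w = y \<circ> z"
    by (simp add: z_def Sn_inv_comp [OF yS] flip: comp_assoc)
  ultimately show thesis using that y by blast
qed

lemma sum_blocks:
  assumes a: "a \<le> n" and Y: "Y \<subseteq> {y. y permutes {1..a}}" and Z: "Z \<subseteq> {z. z permutes {Suc a..n}}"
  shows "(\<Sum>w\<in>(\<lambda>(y, z). y \<circ> z) ` (Y \<times> Z). f w * tt ^ len n w)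
    = (\<Sum>y\<in>Y. \<Sum>z\<in>Z. f (y \<circ> z) * (tt ^ len n y * tt ^ len n z))"
proof -
  have "inj_on (\<lambda>(y, z). y \<circ> z) (Y \<times> Z)"
    using Y Z by (intro inj_on_subset [OF block_inj [of a n]]) auto
  then have "(\<Sum>w\<in>(\<lambda>(y, z). y \<circ> z) ` (Y \<times> Z). f w * tt ^ len n w)
      = (\<Sum>(y, z)\<in>Y \<times> Z. f (y \<circ> z) * tt ^ len n (y \<circ> z))"
    by (subst sum.reindex) (auto simp: case_prod_unfold)
  also have "\<dots> = (\<Sum>(y, z)\<in>Y \<times> Z. f (y \<circ> z) * (tt ^ len n y * tt ^ len n z))"
  proof (intro sum.cong refl, clarify)
    fix y z assume "y \<in> Y" "z \<in> Z"
    then have "len n (y \<circ> z) = len n y + len n z"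
      using Y Z by (intro len_block [OF a]) auto
    then show "f (y \<circ> z) * tt ^ len n (y \<circ> z) = f (y \<circ> z) * (tt ^ len n y * tt ^ len n z)"
      by (simp add: power_add)
  qed
  finally show ?thesis by (simp add: sum.cartesian_product)
qed

text \<open>The factor inside \<open>S_a\<close> of the stabiliser of
  \<open>\<lambda>k. varpi b k + lam k\<close>, for \<open>lam\<close> supported on
  \<open>{1..a}\<close> and \<open>a \<le> b\<close>; it does not see \<open>b\<close>.\<close>

definition Yblk :: "nat \<Rightarrow> (nat \<Rightarrow> int) \<Rightarrow> (nat \<Rightarrow> nat) set" where
  "Yblk a lam = {y. y permutes {1..a} \<and> (\<forall>k\<in>{1..a}. lam (y k) = lam k)}"

text \<open>The complementary factor, which does not see \<open>lam\<close>; for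
  \<open>b = n\<close> it consists of all permutations of \<open>{Suc a..n}\<close>.\<close>

definition Zblk :: "nat \<Rightarrow> nat \<Rightarrow> nat \<Rightarrow> (nat \<Rightarrow> nat) set" where
  "Zblk n a b = {z. z permutes {Suc a..n} \<and> z \<in> stab n (varpi b)}"

text \<open>The weight is at least 2 on \<open>1, ..., a\<close>, equals 1 on
  \<open>a + 1, ..., b\<close> and 0 beyond, so its stabiliser respects these blocks; inside the
  first block only \<open>lam\<close> matters.\<close>

lemma stab_blocks:
  assumes ab: "a \<le> b" "b \<le> n"
    and pos: "\<And>k. k \<in> {1..a} \<Longrightarrow> 1 \<le> lam k" and zero: "\<And>k. a < k \<Longrightarrow> lam k = 0"
  shows "stab n (\<lambda>k. varpi b k + lam k) = (\<lambda>(y, z). y \<circ> z) ` (Yblk a lam \<times> Zblk n a b)"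
    (is "?L = ?R")
proof (intro equalityI subsetI)
  fix w assume w: "w \<in> ?L"
  then have wS: "w \<in> Sn n" by (rule stab_in_Sn)
  have eq: "varpi b (w k) + lam (w k) = varpi b k + lam k" if "k \<in> {1..n}" for k
    using w that by (simp add: stab_def)
  have val: "(k \<le> a \<longleftrightarrow> 2 \<le> varpi b k + lam k) \<and> (k \<le> b \<longleftrightarrow> 1 \<le> varpi b k + lam k)"
    if "k \<in> {1..n}" for k
    using that pos [of k] zero [of k] ab by (cases "k \<le> a"; cases "k \<le> b") (auto simp: varpi_def)
  have iff: "(w k \<le> a \<longleftrightarrow> k \<le> a) \<and> (w k \<le> b \<longleftrightarrow> k \<le> b)" if k: "k \<in> {1..n}" for k
    using val [OF k] val [of "w k"] eq [OF k] Sn_range [OF wS, of k] k by simp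
  then have "w \<in> stab n (varpi a)"
    using wS by (simp add: stab_varpi_iff)
  then obtain y z where yz: "y permutes {1..a}" "z permutes {Suc a..n}" "w = y \<circ> z"
    using block_split ab by (metis order_trans)
  note bl = block_permutes [OF yz(1,2)]
  have "lam (y k) = lam k" if k: "k \<in> {1..a}" for k
  proof -
    have "y k = w k" using k bl(1) [of k] yz(3) by simp
    moreover have "y k \<in> {1..a}" using k permutes_in_image [OF yz(1)] by blast
    ultimately show ?thesis
      using eq [of k] k ab by (simp add: varpi_def)
  qed
  moreover have "z k \<le> b \<longleftrightarrow> k \<le> b" if k: "k \<in> {1..n}" for k
    using iff [OF k] bl(1) [of k] bl(4) [of k] bl(3) [of "z k"] yz(3) ab by (cases "k \<le> a") auto
  then have "z \<in> stab n (varpi b)"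
    using permutes_in_Sn(1) [OF yz(2)] by (simp add: stab_varpi_iff)
  ultimately show "w \<in> ?R" using yz by (auto simp: Yblk_def Zblk_def)
next
  fix w assume "w \<in> ?R"
  then obtain y z where yz: "y permutes {1..a}" "z permutes {Suc a..n}" "w = y \<circ> z"
    and lam: "\<And>k. k \<in> {1..a} \<Longrightarrow> lam (y k) = lam k" and z: "z \<in> stab n (varpi b)"
    by (auto simp: Yblk_def Zblk_def)
  note bl = block_permutes [OF yz(1,2)]
  have wS: "w \<in> Sn n"
    using Sn_comp [OF permutes_in_Sn(2) [OF _ yz(1)] permutes_in_Sn(1) [OF yz(2)]] yz(3) ab by simp
  have "varpi b (w k) + lam (w k) = varpi b k + lam k" if k: "k \<in> {1..n}" for k
  proof (cases "k \<le> a")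
    case True
    then have wk: "w k = y k" using bl(1) [of k] yz(3) by simp
    have "y k \<in> {1..a}" using k True permutes_in_image [OF yz(1), of k] by simp
    then show ?thesis
      using lam [of k] k True ab by (simp add: wk varpi_def)
  next
    case False
    then have wk: "w k = z k" and zk: "a < z k"
      using bl(3) [of "z k"] bl(4) [of k] yz(3) by auto
    have "z k \<le> b \<longleftrightarrow> k \<le> b"
      using z k by (simp add: stab_varpi_iff)
    then show ?thesis
      using False zk zero k by (simp add: wk varpi_def)
  qed
  then show "w \<in> ?L"
    using wS by (simp add: stab_def)
qed

text \<open>\<open>varpi n\<close> is invariant under \<open>Sn n\<close>, so adding it does not
  change the stabiliser and the case \<open>b = n\<close> applies.\<close>

lemma stab_blocks_le:
  assumes "a \<le> n" and "\<And>k. k \<in> {1..a} \<Longrightarrow> 1 \<le> lam k" and "\<And>k. a < k \<Longrightarrow> lam k = 0"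
  shows "stab n lam = (\<lambda>(y, z). y \<circ> z) ` (Yblk a lam \<times> Zblk n a n)"
proof -
  have "varpi n (w k) = varpi n k" if "w \<in> Sn n" "k \<in> {1..n}" for w k
    using Sn_range [of w n k] that by (simp add: varpi_def)
  then have "stab n lam = stab n (\<lambda>k. varpi n k + lam k)"
    by (auto simp: stab_def)
  then show ?thesis
    using stab_blocks [of a n n lam] assms by simp
qed

lemma stab_varpi_blocks:
  "a \<le> b \<Longrightarrow> b \<le> n \<Longrightarrow> stab n (\<lambda>k. varpi b k + varpi a k)
    = (\<lambda>(y, z). y \<circ> z) ` (Yblk a (varpi a) \<times> Zblk n a b)"
  by (intro stab_blocks) (auto simp: varpi_def)

lemma stab_varpi_blocks_le:
  "a \<le> n \<Longrightarrow> stab n (varpi a) = (\<lambda>(y, z). y \<circ> z) ` (Yblk a (varpi a) \<times> Zblk n a n)"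
  by (intro stab_blocks_le) (auto simp: varpi_def)

lemma sum_Y_Z:
  assumes "a \<le> n"
  shows "(\<Sum>w\<in>(\<lambda>(y, z). y \<circ> z) ` (Yblk a lam \<times> Zblk n a b). f w * tt ^ len n w)
    = (\<Sum>y\<in>Yblk a lam. \<Sum>z\<in>Zblk n a b. f (y \<circ> z) * (tt ^ len n y * tt ^ len n z))"
  by (rule sum_blocks [OF assms]) (auto simp: Yblk_def Zblk_def)

lemma Wpoly_blocks:
  assumes "a \<le> n" "stab n mu = (\<lambda>(y, z). y \<circ> z) ` (Yblk a lam \<times> Zblk n a b)"
  shows "Wpoly n mu = (\<Sum>y\<in>Yblk a lam. tt ^ len n y) * (\<Sum>z\<in>Zblk n a b. tt ^ len n z)"
  using sum_Y_Z [OF assms(1), where f = "\<lambda>_. 1"] by (simp add: Wpoly_def assms(2) sum_product)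

text \<open>Each of the four polynomials is a factor for the first \<open>a\<close> points, given by
  \<open>lam\<close> or \<open>varpi a\<close>, times a factor for the others, given by
  \<open>b\<close> or \<open>n\<close>; both sides contain each factor once. The identity links the
  normalisations of a tensor, its first pair and its tail.\<close>

lemma Wpoly_cross:
  assumes ab: "a \<le> b" "b \<le> n"
    and pos: "\<And>k. k \<in> {1..a} \<Longrightarrow> 1 \<le> lam k" and zero: "\<And>k. a < k \<Longrightarrow> lam k = 0"
  shows "Wpoly n (\<lambda>k. varpi b k + lam k) * Wpoly n (varpi a)
    = Wpoly n (\<lambda>k. varpi b k + varpi a k) * Wpoly n lam"
proof -
  have a: "a \<le> n" using ab by simp
  have "stab n (\<lambda>k. varpi b k + lam k) = (\<lambda>(y, z). y \<circ> z) ` (Yblk a lam \<times> Zblk n a b)"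
    "stab n lam = (\<lambda>(y, z). y \<circ> z) ` (Yblk a lam \<times> Zblk n a n)"
    using stab_blocks [OF ab] stab_blocks_le [OF a] pos zero by blast+
  note lam = this [THEN Wpoly_blocks [OF a]]
  show ?thesis
    unfolding lam stab_varpi_blocks [OF ab, THEN Wpoly_blocks [OF a]]
      stab_varpi_blocks_le [OF a, THEN Wpoly_blocks [OF a]]
    by (simp add: algebra_simps)
qed

lemma Wpoly_neq_0: "Wpoly n lam \<noteq> 0"
proof -
  have "id \<in> stab n lam" by (simp add: stab_def)
  then have "0 < Wpoly n lam"
    unfolding Wpoly_def using tt_pos by (intro sum_pos) auto
  then show ?thesis by simp
qed

section \<open>Component sums for the initial column\<close>

lemma ucol_fixes_initial:
  assumes C: "C \<subseteq> {1..n}" and sub: "{1..a} \<subseteq> C"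
  shows "k \<le> a \<Longrightarrow> ucol n C k = k"
proof (induction k rule: less_induct)
  case (less k)
  let ?u = "ucol n C"
  note u = ucol_in_Sn [OF C]
  show ?case
  proof (cases "k = 0")
    case True
    then show ?thesis by (simp add: ucol_def)
  next
    case False
    then have kC: "k \<in> C" using less.prems sub by auto
    then have kn: "k \<in> {1..n}" using C by blast
    have ge: "k \<le> ?u k"
    proof (rule ccontr)
      assume "\<not> k \<le> ?u k"
      then show False
        using less.IH [of "?u k"] less.prems Sn_eq_iff [OF u, of "?u k" k] by simp
    qed
    define m where "m = inv ?u k"
    have um: "?u m = k" by (simp add: m_def Sn_inv_eq [OF u])
    have "k \<le> m"
      using less.IH [of m] less.prems um by (cases "k \<le> m") auto
    moreover have "m \<le> card C"
      using inv_ucol_le_iff [OF C kn] kC by (simp add: m_def)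
    moreover have "?u k < ?u m" if "k < m"
      using that False \<open>m \<le> card C\<close> card_col_le [OF C] by (intro ucol_mono [OF C]) auto
    ultimately show ?thesis
      using um ge by (cases "m = k") auto
  qed
qed

text \<open>If \<open>{1..a}\<close> is not inside \<open>C\<close>, no
  \<open>ucol n C \<circ> w\<close> in the sum preserves \<open>{1..a}\<close>, so every term is
  zero. Otherwise \<open>ctr\<close> and \<open>eps\<close> are the same sum over permutations of
  \<open>{1..a}\<close> times a sum over \<open>Zblk n a (card C)\<close> or
  \<open>Zblk n a n\<close>; the product form of \<open>Wpoly\<close> yields the ratio.\<close>

lemma ctr_base:
  assumes C: "C \<subseteq> {1..n}" and ab: "a \<le> card C" and h: "h \<in> Hpar n (varpi a)" and inv: "rinv n a h"
  shows "ctr n h C * Wpoly n (varpi a)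
    = (if {1..a} \<subseteq> C then Wpoly n (\<lambda>k. varpi (card C) k + varpi a k) * eps n h else 0)"
proof -
  let ?u = "ucol n C"
  let ?b = "card C"
  have b: "?b \<le> n" by (rule card_col_le [OF C])
  have a: "a \<le> n" using ab b by simp
  note u = ucol_in_Sn [OF C]
  show ?thesis
  proof (cases "{1..a} \<subseteq> C")
    case False
    have "h (?u \<circ> w) = 0" if w: "w \<in> stab n (varpi ?b)" for w
    proof (rule Hpar_outside [OF h], rule notI)
      assume "?u \<circ> w \<in> stab n (varpi a)"
      then have "{1..a} = ?u ` (w ` {1..a})"
        unfolding stab_varpi_image_iff [OF a] image_comp [symmetric] by simp
      also have "\<dots> \<subseteq> ?u ` (w ` {1..?b})"
        using ab by (intro image_mono) auto
      also have "\<dots> = C"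
        using w ucol_image [OF C] by (simp add: stab_varpi_image_iff [OF b])
      finally show False using False by simp
    qed
    then show ?thesis using False by (simp add: ctr_def)
  next
    case True
    let ?mu = "\<lambda>k. varpi ?b k + varpi a k"
    have up: "?u permutes {Suc a..n}"
      using u ucol_fixes_initial [OF C True] unfolding Sn_def
      by (auto elim!: permutes_superset)
    have ua: "?u \<in> stab n (varpi a)"
      using u ucol_fixes_initial [OF C True] by (simp add: stab_varpi_image_iff [OF a])
    \<comment> \<open>As \<open>a\<close> is at most \<open>card C\<close>, the two indicator
      weights are nested, so their sum determines both.\<close>
    have mu: "w \<in> stab n ?mu \<longleftrightarrow> w \<in> stab n (varpi ?b) \<and> w \<in> stab n (varpi a)" for w
    proof (cases "w \<in> Sn n")
      case w: True
      have "varpi ?b (w k) + varpi a (w k) = varpi ?b k + varpi a k \<longleftrightarrow>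
          varpi ?b (w k) = varpi ?b k \<and> varpi a (w k) = varpi a k" for k
        using ab by (auto simp: varpi_def)
      then show ?thesis by (auto simp: stab_def)
    qed (simp add: stab_def)
    have "ctr n h C = (\<Sum>w\<in>stab n ?mu. h (?u \<circ> w) * tt ^ len n w)"
      unfolding ctr_def
    proof (rule sum.mono_neutral_right)
      show "stab n ?mu \<subseteq> stab n (varpi ?b)" using mu by blast
      show "\<forall>w\<in>stab n (varpi ?b) - stab n ?mu. h (?u \<circ> w) * tt ^ len n w = 0"
      proof
        fix w assume w: "w \<in> stab n (varpi ?b) - stab n ?mu"
        have "?u \<circ> w \<notin> stab n (varpi a)"
        proof
          assume "?u \<circ> w \<in> stab n (varpi a)"
          then have "inv ?u \<circ> (?u \<circ> w) \<in> stab n (varpi a)"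
            by (rule stab_varpi_comp [OF stab_varpi_inv [OF ua]])
          then show False
            using w mu by (simp add: Sn_inv_comp [OF u] flip: comp_assoc)
        qed
        then show "h (?u \<circ> w) * tt ^ len n w = 0"
          by (simp add: Hpar_outside [OF h])
      qed
    qed simp
    also have "\<dots> = (\<Sum>y\<in>Yblk a (varpi a). \<Sum>z\<in>Zblk n a ?b. h (?u \<circ> (y \<circ> z)) * (tt ^ len n y * tt ^ len n z))"
      unfolding stab_varpi_blocks [OF ab b] by (rule sum_Y_Z [OF a])
    also have "\<dots> = (\<Sum>y\<in>Yblk a (varpi a). \<Sum>z\<in>Zblk n a ?b. (h y * tt ^ len n y) * tt ^ len n z)"
    proof (intro sum.cong refl)
      fix y z assume "y \<in> Yblk a (varpi a)" "z \<in> Zblk n a ?b"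
      then have y: "y permutes {1..a}" and z: "z permutes {Suc a..n}"
        by (auto simp: Yblk_def Zblk_def)
      \<comment> \<open>\<open>?u\<close> permutes the last block, so it passes \<open>y\<close> and
        is absorbed by right invariance together with \<open>z\<close>.\<close>
      have "?u \<circ> (y \<circ> z) = y \<circ> (?u \<circ> z)"
        using block_commute [OF y up] by (simp flip: comp_assoc)
      then have "h (?u \<circ> (y \<circ> z)) = h y"
        using inv permutes_in_Sn(2) [OF a y] permutes_compose [OF z up] by (simp add: rinv_def)
      then show "h (?u \<circ> (y \<circ> z)) * (tt ^ len n y * tt ^ len n z) = (h y * tt ^ len n y) * tt ^ len n z"
        by simp
    qed
    finally have c: "ctr n h C = (\<Sum>y\<in>Yblk a (varpi a). h y * tt ^ len n y) * (\<Sum>z\<in>Zblk n a ?b. tt ^ len n z)"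
      by (simp only: sum_product)
    have "eps n h = (\<Sum>w\<in>stab n (varpi a). h w * tt ^ len n w)"
      unfolding eps_def using stab_in_Sn
      by (intro sum.mono_neutral_right) (auto simp: Hpar_outside [OF h])
    also have "\<dots> = (\<Sum>y\<in>Yblk a (varpi a). \<Sum>z\<in>Zblk n a n. h (y \<circ> z) * (tt ^ len n y * tt ^ len n z))"
      unfolding stab_varpi_blocks_le [OF a] by (rule sum_Y_Z [OF a])
    also have "\<dots> = (\<Sum>y\<in>Yblk a (varpi a). \<Sum>z\<in>Zblk n a n. (h y * tt ^ len n y) * tt ^ len n z)"
    proof (intro sum.cong refl)
      fix y z assume "y \<in> Yblk a (varpi a)" "z \<in> Zblk n a n"
      then have "h (y \<circ> z) = h y"
        using inv permutes_in_Sn(2) [OF a, of y] by (auto simp: rinv_def Yblk_def Zblk_def)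
      then show "h (y \<circ> z) * (tt ^ len n y * tt ^ len n z) = (h y * tt ^ len n y) * tt ^ len n z"
        by simp
    qed
    finally have e: "eps n h = (\<Sum>y\<in>Yblk a (varpi a). h y * tt ^ len n y) * (\<Sum>z\<in>Zblk n a n. tt ^ len n z)"
      by (simp only: sum_product)
    show ?thesis
      unfolding c e Wpoly_blocks [OF a stab_varpi_blocks [OF ab b]]
        Wpoly_blocks [OF a stab_varpi_blocks_le [OF a]]
      using True by (simp add: algebra_simps)
  qed
qed

lemma LU_ucol_scol:
  assumes D: "D \<subseteq> {1..n}" and j: "j \<in> {1..<n}" and up: "j \<in> D" "Suc j \<notin> D" and g: "g \<in> Hn n"
  shows "LU n (ucol n (scol j D)) g = Lop n j (LU n (ucol n D) g)"
proof -
  have "ucol n (scol j D) = sw j \<circ> ucol n D"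
    by (rule ucol_scol [OF D j]) (use up in blast)
  moreover have "inv (ucol n D) j < inv (ucol n D) (Suc j)"
    using inv_ucol_le_iff [OF D, of j] inv_ucol_le_iff [OF D, of "Suc j"] up j by auto
  ultimately show ?thesis
    using LU_sw_comp [OF ucol_in_Sn [OF D] j _ g] by simp
qed

lemma one_par_in_Hpar: "one_par n lam \<in> Hpar n lam"
  by (rule HparI) (simp add: one_par_def)

lemma eps_one_par: "eps n (one_par n lam) = Wpoly n lam"
proof -
  have "eps n (one_par n lam) = (\<Sum>w\<in>stab n lam. one_par n lam w * tt ^ len n w)"
    unfolding eps_def using stab_in_Sn by (intro sum.mono_neutral_right) (auto simp: one_par_def)
  then show ?thesis by (simp add: Wpoly_def one_par_def)
qed

lemma permutes_in_stab: "z permutes {Suc a..n} \<Longrightarrow> z \<in> stab n (varpi a)"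
proof -
  assume z: "z permutes {Suc a..n}"
  have "z k \<le> a \<longleftrightarrow> k \<le> a" if "k \<in> {1..n}" for k
    using permutes_not_in [OF z, of k] permutes_in_image [OF z, of k] that
    by (cases "k \<le> a") auto
  then show ?thesis
    using permutes_in_Sn(1) [OF z] by (simp add: stab_varpi_iff)
qed

lemma stab_comp_iff:
  assumes v: "v \<in> Sn n" and z: "z \<in> stab n (varpi a)"
  shows "v \<circ> z \<in> stab n (varpi a) \<longleftrightarrow> v \<in> stab n (varpi a)"
proof
  assume "v \<circ> z \<in> stab n (varpi a)"
  then have "v \<circ> z \<circ> inv z \<in> stab n (varpi a)"
    by (rule stab_varpi_comp [OF _ stab_varpi_inv [OF z]])
  then show "v \<in> stab n (varpi a)"
    by (simp add: comp_assoc Sn_inv_comp [OF stab_in_Sn [OF z]])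
qed (rule stab_varpi_comp [OF _ z])

lemma rinv_one_par: "rinv n a (one_par n (varpi a))"
  unfolding rinv_def one_par_def using stab_comp_iff [OF _ permutes_in_stab] by auto

lemma ell_scale:
  "g C = c * f C \<Longrightarrow> g (scol j C) = c * f (scol j C) \<Longrightarrow> ell j g C = c * ell j f C"
  by (simp add: ell_def algebra_simps)

text \<open>For \<open>D = {1..a}\<close> both sides come from \<open>ctr_base\<close>. A step from
  \<open>D\<close> to \<open>scol j D\<close> applies the linear operator \<open>ell j\<close> to
  both sides, so the scalar, which does not involve \<open>D\<close>, is carried along.\<close>

lemma ctr_LU_factor:
  assumes D: "D \<subseteq> {1..n}" "card D = a" and h: "h \<in> Hpar n (varpi a)" and inv: "rinv n a h"
    and C: "C \<subseteq> {1..n}" "a \<le> card C"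
  shows "ctr n (LU n (ucol n D) h) C
    = eps n h / Wpoly n (varpi a) * ctr n (LU n (ucol n D) (one_par n (varpi a))) C"
  using D C
proof (induction D arbitrary: C rule: col_induct)
  case base
  let ?one = "one_par n (varpi a)"
  have a: "a \<le> n" using base card_col_le [OF base(1)] by simp
  have eq: "LU n (ucol n {1..a}) h = h" "LU n (ucol n {1..a}) ?one = ?one"
    by (simp_all only: ucol_initial [OF a] LU_id Hpar_Hn [OF h] Hpar_Hn [OF one_par_in_Hpar])
  show ?case
    unfolding eq
    using ctr_base [OF base h inv] ctr_base [OF base one_par_in_Hpar rinv_one_par]
      Wpoly_neq_0 [of n "varpi a"]
    by (simp add: eps_one_par field_simps split: if_splits)
next
  case (step D j)
  note Ls = LU_ucol_scol [OF step(1,3,4,5) Hpar_Hn]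
  show ?case
    unfolding Ls [OF h] Ls [OF one_par_in_Hpar] ctr_Lop [OF step.prems(1) step(3)]
    using step by (intro ell_scale step.IH scol_subset) auto
qed

section \<open>Factorisation of the tensor value\<close>

lemma Psi_Cons: "Psi n (C # S) = LU n (ucol n C)
    (if S = [] then one_par n (varpi (card C)) else decomp n (card C) (Psi n S) C)"
  by (cases S) (simp_all add: LU_def)

text \<open>Right invariance passes from the tail to the next component because the invariance group
  shrinks as columns get longer: permutations of the points above \<open>card D\<close> are among
  those of the points above \<open>card E\<close>.\<close>

lemma Psi_form:
  assumes "\<forall>C\<in>set (D # S). C \<subseteq> {1..n}" "sorted_wrt (\<lambda>C D. card D \<le> card C) (D # S)"
  shows "\<exists>h\<in>Hpar n (varpi (card D)). rinv n (card D) h \<and> Psi n (D # S) = LU n (ucol n D) h"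
  using assms
proof (induction S arbitrary: D)
  case Nil
  then show ?case
    unfolding Psi_Cons by (auto intro!: bexI [of _ "one_par n (varpi (card D))"] one_par_in_Hpar rinv_one_par)
next
  case (Cons E S)
  let ?a = "card D"
  have D: "D \<subseteq> {1..n}" and E: "E \<subseteq> {1..n}" and le: "card E \<le> ?a"
    using Cons.prems by auto
  obtain h where h: "h \<in> Hpar n (varpi (card E))" "rinv n (card E) h" "Psi n (E # S) = LU n (ucol n E) h"
    using Cons.IH [of E] Cons.prems by (simp only: list.set ball_simps sorted_wrt.simps) blast
  have H: "Psi n (E # S) \<in> Hn n"
    unfolding h(3) by (rule LU_in_Hn [OF ucol_in_Sn [OF E] Hpar_Hn [OF h(1)]])
  have R: "rinv n (card E) (Psi n (E # S))"
    unfolding h(3) by (rule rinv_LU [OF ucol_in_Sn [OF E] Hpar_Hn [OF h(1)] h(2)])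
  let ?g = "\<lambda>w. if w \<in> stab n (varpi ?a) then Psi n (E # S) (ucol n D \<circ> w) else 0"
  have "decomp n ?a (Psi n (E # S)) D = ?g"
    by (rule decomp_eq [OF H]) (use D in \<open>simp add: cols_def\<close>)
  then have "Psi n (D # E # S) = LU n (ucol n D) ?g"
    by (simp only: Psi_Cons [of n D "E # S"] list.distinct if_False)
  moreover have "?g \<in> Hpar n (varpi ?a)"
    by (rule HparI) simp
  moreover have "rinv n ?a ?g"
    unfolding rinv_def
  proof (intro ballI allI impI)
    fix v z assume v: "v \<in> Sn n" and z: "z permutes {Suc ?a..n}"
    have "z permutes {Suc (card E)..n}"
      by (rule permutes_subset [OF z]) (use le in auto)
    then have "Psi n (E # S) (ucol n D \<circ> v \<circ> z) = Psi n (E # S) (ucol n D \<circ> v)"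
      using R Sn_comp [OF ucol_in_Sn [OF D] v] unfolding rinv_def by blast
    then show "?g (v \<circ> z) = ?g v"
      using stab_comp_iff [OF v permutes_in_stab [OF z]] by (simp add: comp_assoc)
  qed
  ultimately show ?case by blast
qed

lemma eps_Psi_Cons:
  assumes C: "C \<subseteq> {1..n}" and H: "Psi n (D # S) \<in> Hn n"
  shows "eps n (Psi n (C # D # S)) = ctr n (Psi n (D # S)) C"
proof -
  let ?X = "stab n (varpi (card C))"
  let ?g = "\<lambda>w. if w \<in> ?X then Psi n (D # S) (ucol n C \<circ> w) else 0"
  have "decomp n (card C) (Psi n (D # S)) C = ?g"
    by (rule decomp_eq [OF H]) (use C in \<open>simp add: cols_def\<close>)
  then have "Psi n (C # D # S) = LU n (ucol n C) ?g"
    by (simp only: Psi_Cons [of n C "D # S"] list.distinct if_False)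
  moreover have "?g \<in> Hn n"
    by (rule HnI) (auto dest: stab_in_Sn)
  ultimately have "eps n (Psi n (C # D # S)) = eps n ?g"
    using eps_LU [OF ucol_in_Sn [OF C]] by simp
  also have "\<dots> = (\<Sum>w\<in>?X. ?g w * tt ^ len n w)"
    unfolding eps_def using stab_in_Sn by (intro sum.mono_neutral_right) auto
  also have "\<dots> = ctr n (Psi n (D # S)) C"
    by (simp add: ctr_def)
  finally show ?thesis .
qed

lemma psit_eq: "psit n Ts = eps n (Psi n Ts) / Wpoly n (shape Ts)"
  by (simp add: psit_def eps_def divide_inverse mult.commute)

lemma psit_pair:
  assumes C: "C \<subseteq> {1..n}" and D: "D \<subseteq> {1..n}"
  shows "psit n [C, D] = inverse (Wpoly n (\<lambda>k. varpi (card C) k + varpi (card D) k))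
    * ctr n (LU n (ucol n D) (one_par n (varpi (card D)))) C"
proof -
  have P: "Psi n [D] = LU n (ucol n D) (one_par n (varpi (card D)))"
    unfolding Psi_Cons by simp
  then have "Psi n [D] \<in> Hn n"
    using LU_in_Hn [OF ucol_in_Sn [OF D] Hpar_Hn [OF one_par_in_Hpar]] by simp
  then have "eps n (Psi n [C, D]) = ctr n (LU n (ucol n D) (one_par n (varpi (card D)))) C"
    using eps_Psi_Cons [OF C] P by metis
  then show ?thesis
    by (simp add: psit_eq shape_def divide_inverse mult.commute)
qed

lemma psit_Cons:
  assumes T: "tensor n (C # D # S)"
  shows "psit n (C # D # S) = psit n [C, D] * psit n (D # S)"
proof -
  let ?a = "card D" and ?b = "card C" and ?lam = "shape (D # S)"
  have C: "C \<subseteq> {1..n}" and D: "D \<subseteq> {1..n}" and ab: "?a \<le> ?b"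
    using T by (auto simp: tensor_def)
  obtain h where h: "h \<in> Hpar n (varpi ?a)" "rinv n ?a h" "Psi n (D # S) = LU n (ucol n D) h"
    using Psi_form [of D S n] T by (auto simp: tensor_def)
  have H: "Psi n (D # S) \<in> Hn n"
    unfolding h(3) by (rule LU_in_Hn [OF ucol_in_Sn [OF D] Hpar_Hn [OF h(1)]])
  have e: "eps n (Psi n (D # S)) = eps n h"
    unfolding h(3) by (rule eps_LU [OF ucol_in_Sn [OF D] Hpar_Hn [OF h(1)]])
  have c: "eps n (Psi n (C # D # S)) = eps n h / Wpoly n (varpi ?a)
      * ctr n (LU n (ucol n D) (one_par n (varpi ?a))) C"
    unfolding eps_Psi_Cons [OF C H] h(3) by (rule ctr_LU_factor [OF D refl h(1,2) C ab])
  \<comment> \<open>\<open>D\<close> is the longest column of the tail, so the shape of the tail is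
    positive on \<open>{1..?a}\<close> and zero beyond, as the block factorisation requires.\<close>
  have "1 \<le> ?lam k" if "k \<in> {1..?a}" for k
  proof -
    have "0 \<le> (\<Sum>C\<leftarrow>S. varpi (card C) k)"
      by (rule sum_list_nonneg) (auto simp: varpi_def)
    then show ?thesis using that by (simp add: shape_def varpi_def)
  qed
  moreover have "?lam k = 0" if "?a < k" for k
  proof -
    have "(\<Sum>C\<leftarrow>S. varpi (card C) k) = (\<Sum>C\<leftarrow>S. 0)"
      using T that by (intro arg_cong [of _ _ sum_list] map_cong refl) (auto simp: varpi_def tensor_def)
    then show ?thesis using that by (simp add: shape_def varpi_def)
  qed
  ultimately have W: "Wpoly n (\<lambda>k. varpi ?b k + ?lam k) * Wpoly n (varpi ?a)
      = Wpoly n (\<lambda>k. varpi ?b k + varpi ?a k) * Wpoly n ?lam"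
    by (intro Wpoly_cross [OF ab card_col_le [OF C]])
  have s: "shape (C # D # S) = (\<lambda>k. varpi ?b k + ?lam k)"
    by (simp add: shape_def)
  \<comment> \<open>\<open>A\<close>, \<open>B\<close>, \<open>E\<close>, \<open>L\<close> stand for
    \<open>Wpoly\<close> at the whole shape, at \<open>varpi ?a\<close>, at the first pair and at
    the tail, tied together by \<open>Wpoly_cross\<close>.\<close>
  have "x / B * y / A = inverse E * y * (x / L)" if "A * B = E * L" for x y A B E L :: coef
  proof -
    have "x / B * y / A = x * y / (A * B)" by (simp add: mult.commute)
    also have "\<dots> = inverse E * y * (x / L)" unfolding that by (simp add: divide_inverse)
    finally show ?thesis .
  qed
  from this [OF W] show ?thesis
    unfolding psit_pair [OF C D] psit_eq [of n "C # D # S"] psit_eq [of n "D # S"] c e s .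
qed

subsection \<open>Pairs of columns\<close>

lemma psit_initial:
  assumes C: "C \<subseteq> {1..n}" and a: "a \<le> card C"
  shows "psit n [C, {1..a}] = (if {1..a} \<subseteq> C then 1 else 0)"
proof -
  have an: "a \<le> n" using a card_col_le [OF C] by simp
  then have sub: "{1..a} \<subseteq> {1..n}" by auto
  have "LU n (ucol n {1..a}) (one_par n (varpi a)) = one_par n (varpi a)"
    by (simp only: ucol_initial [OF an] LU_id [OF Hpar_Hn [OF one_par_in_Hpar]])
  then have "psit n [C, {1..a}] = inverse (Wpoly n (\<lambda>k. varpi (card C) k + varpi a k))
      * ctr n (one_par n (varpi a)) C"
    using psit_pair [OF C sub] by simp
  then show ?thesis
    using ctr_base [OF C a one_par_in_Hpar rinv_one_par]
      Wpoly_neq_0 [of n "varpi a"] Wpoly_neq_0 [of n "\<lambda>k. varpi (card C) k + varpi a k"]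
    by (cases "{1..a} \<subseteq> C") (simp_all add: eps_one_par)
qed

text \<open>The normalising factor depends only on the column lengths, which \<open>scol\<close>
  preserves, so a relation by \<open>Lop j\<close> for the right column becomes a relation by
  \<open>ell j\<close> in the left one.\<close>

lemma psit_ell:
  assumes C: "C \<subseteq> {1..n}" and D: "D \<subseteq> {1..n}" and D': "D' \<subseteq> {1..n}" "card D' = card D"
    and j: "j \<in> {1..<n}"
    and eq: "LU n (ucol n D') (one_par n (varpi (card D)))
      = Lop n j (LU n (ucol n D) (one_par n (varpi (card D))))"
  shows "psit n [C, D'] = ell j (\<lambda>C. psit n [C, D]) C"
proof -
  have "ell j (\<lambda>C. psit n [C, D]) C = inverse (Wpoly n (\<lambda>k. varpi (card C) k + varpi (card D) k))
      * ell j (ctr n (LU n (ucol n D) (one_par n (varpi (card D))))) C"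
    using psit_pair [OF C D] psit_pair [OF scol_subset [OF C j] D] by (intro ell_scale) simp_all
  then show ?thesis
    using psit_pair [OF C D'(1)] unfolding D'(2) eq ctr_Lop [OF C j] by simp
qed

lemma psit_scol_up:
  assumes "C \<subseteq> {1..n}" and D: "D \<subseteq> {1..n}" and j: "j \<in> {1..<n}" and up: "j \<in> D" "Suc j \<notin> D"
  shows "psit n [C, scol j D] = ell j (\<lambda>C. psit n [C, D]) C"
  by (rule psit_ell [OF assms(1) D scol_subset [OF D j] card_scol j
        LU_ucol_scol [OF D j up Hpar_Hn [OF one_par_in_Hpar]]])

text \<open>If \<open>s\<^sub>j D = D\<close> then \<open>s\<^sub>j u\<^sub>D = u\<^sub>D s\<^sub>k\<close> with \<open>s\<^sub>k\<close> in the parabolic subgroup.\<close>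
lemma psit_scol_fixed:
  assumes C: "C \<subseteq> {1..n}" and D: "D \<subseteq> {1..n}" and j: "j \<in> {1..<n}" and fixed: "j \<in> D \<longleftrightarrow> Suc j \<in> D"
  shows "psit n [C, D] = ell j (\<lambda>C. psit n [C, D]) C"
proof -
  let ?u = "ucol n D" and ?one = "one_par n (varpi (card D))"
  note u = ucol_in_Sn [OF D] and one = Hpar_Hn [OF one_par_in_Hpar]
  obtain k where k: "k \<in> {1..<n}" "k \<noteq> card D" "?u k = j" "?u (Suc k) = Suc j"
    using ucol_fixed [OF D j fixed] by blast
  have iu: "inv ?u j = k" "inv ?u (Suc j) = Suc k"
    using k Sn_inv_eq(1) [OF u] by metis+
  have one_k: "Lop n k ?one = ?one"
  proof
    fix v
    show "Lop n k ?one v = ?one v"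
    proof (cases "v \<in> Sn n")
      case v: True
      note sk = sw_in_stab_varpi [OF k(1,2)]
      have "sw k \<circ> v \<in> stab n (varpi (card D)) \<longleftrightarrow> v \<in> stab n (varpi (card D))"
        using stab_varpi_comp [OF sk, of v] stab_varpi_comp [OF sk, of "sw k \<circ> v"] by auto
      then have "?one (sw k \<circ> v) = ?one v" by (simp add: one_par_def)
      then show ?thesis by (simp add: Lop_apply [OF v] algebra_simps)
    next
      case False
      then show ?thesis
        using Hn_outside [OF one False] Hn_outside [OF Lop_in_Hn [OF one] False] by simp
    qed
  qed
  have "sw j \<circ> ?u = ?u \<circ> sw k"
    by (rule sw_comp_eq_comp_sw [OF u]) (simp add: k)
  then have "Lop n j (LU n ?u ?one) = LU n (?u \<circ> sw k) ?one"
    using LU_sw_comp [OF u j _ one] iu by simp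
  also have "\<dots> = LU n ?u (Lop n k ?one)"
    using LU_comp_sw [OF u k(1) _ one] k by simp
  finally show ?thesis
    using psit_ell [OF C D D refl j] by (simp add: one_k)
qed

section \<open>Vanishing off semistandard pairs\<close>

lemma card_scol_Int:
  assumes "k \<noteq> j"
  shows "card (scol j C \<inter> {..k}) = card (C \<inter> {..k})"
proof -
  have "scol j C \<inter> {..k} = scol j (C \<inter> {..k})"
    using assms by (auto simp: scol_mem_iff sw_def split: if_splits)
  then show ?thesis by simp
qed

lemma card_scol_Int_le: "card (scol j C \<inter> {..j}) \<le> Suc (card (C \<inter> {..j}))"
proof -
  have "scol j C \<inter> {..j} \<subseteq> insert j (C \<inter> {..j})"
    by (auto simp: scol_mem_iff sw_def split: if_splits)
  then have "card (scol j C \<inter> {..j}) \<le> card (insert j (C \<inter> {..j}))"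
    by (intro card_mono) auto
  then show ?thesis
    using card_insert_le_m1 [of "Suc (card (C \<inter> {..j}))" "C \<inter> {..j}" j] by simp
qed

lemma card_scol_up_Int:
  assumes "j \<in> D" "Suc j \<notin> D"
  shows "Suc (card (scol j D \<inter> {..j})) = card (D \<inter> {..j})"
proof -
  have "scol j D \<inter> {..j} = D \<inter> {..j} - {j}"
    using assms by (auto simp: scol_up)
  then show ?thesis
    using assms card_Suc_Diff1 [of "D \<inter> {..j}" j] by simp
qed

text \<open>Counts replace row entries because \<open>scol j\<close> affects the count up to
  \<open>k\<close> only for \<open>k = j\<close>. There, raising \<open>D\<close> lowers its count
  by one, and the term with \<open>scol j C\<close> costs at most one in the count of
  \<open>C\<close>, so the inequality survives.\<close>

lemma psit_support:
  assumes "D \<subseteq> {1..n}" "card D = a" "C \<subseteq> {1..n}" "a \<le> card C" "psit n [C, D] \<noteq> 0"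
  shows "card (D \<inter> {..k}) \<le> card (C \<inter> {..k})"
  using assms
proof (induction D arbitrary: C rule: col_induct)
  case base
  then have "{1..a} \<subseteq> C"
    using psit_initial [OF base(1,2)] by metis
  then show ?case by (intro card_mono) auto
next
  case (step D j)
  note C = step.prems(1,2)
  have le: "card (scol j D \<inter> {..k}) \<le> card (D \<inter> {..k})"
    using card_scol_up_Int [OF step(4,5)] card_scol_Int [of k j D] by (cases "k = j") auto
  have "ell j (\<lambda>C. psit n [C, D]) C \<noteq> 0"
    using step.prems psit_scol_up [OF C(1) step(1,3,4,5)] by simp
  then have "psit n [C, D] \<noteq> 0 \<or> psit n [scol j C, D] \<noteq> 0"
    by (auto simp: ell_def split: if_splits)
  then consider "psit n [C, D] \<noteq> 0" | "psit n [scol j C, D] \<noteq> 0"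
    by blast
  then show ?case
  proof cases
    case 1
    then show ?thesis using step.IH [OF C 1] le by simp
  next
    case 2
    have IH: "card (D \<inter> {..k}) \<le> card (scol j C \<inter> {..k})"
      using step.IH [OF scol_subset [OF C(1) step(3)] _ 2] C(2) by simp
    show ?thesis
      using IH le card_scol_up_Int [OF step(4,5)] card_scol_Int [of k j C] card_scol_Int_le [of j C]
      by (cases "k = j") auto
  qed
qed

text \<open>Translates row comparisons into counts. Both directions compare
  \<open>C \<inter> {..x}\<close> with an initial piece of the sorted list.\<close>

lemma entry_le_iff:
  assumes fin: "finite C" and i: "1 \<le> i" "i \<le> card C"
  shows "entry C i \<le> x \<longleftrightarrow> i \<le> card (C \<inter> {..x})"
proof -
  let ?xs = "sorted_list_of_set C"
  have xs: "set ?xs = C" "length ?xs = card C" "distinct ?xs" using fin by simp_all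
  have less: "?xs ! p < ?xs ! q" if "p < q" "q < card C" for p q
    using sorted_list_of_set_nth_less [OF fin that] .
  have inj: "inj_on ((!) ?xs) {..<m}" if "m \<le> card C" for m
    using that xs by (auto intro!: inj_on_nth)
  show ?thesis
  proof
    assume le: "entry C i \<le> x"
    have "(!) ?xs ` {..<i} \<subseteq> C \<inter> {..x}"
    proof
      fix y assume "y \<in> (!) ?xs ` {..<i}"
      then obtain p where p: "p < i" "y = ?xs ! p" by auto
      then have "y \<le> entry C i"
        using less [of p "i - 1"] i by (cases "p = i - 1") (auto simp: entry_def intro: less_imp_le)
      moreover have "y \<in> C"
        using p i xs nth_mem [of p ?xs] by simp
      ultimately show "y \<in> C \<inter> {..x}" using le by simp
    qed
    then have "card ((!) ?xs ` {..<i}) \<le> card (C \<inter> {..x})"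
      using fin by (intro card_mono) auto
    then show "i \<le> card (C \<inter> {..x})"
      using card_image [OF inj [OF i(2)]] by simp
  next
    assume le: "i \<le> card (C \<inter> {..x})"
    show "entry C i \<le> x"
    proof (rule ccontr)
      assume gt: "\<not> entry C i \<le> x"
      \<comment> \<open>List positions start at 0, so the first \<open>i - 1\<close> of them carry
        exactly the elements below \<open>entry C i\<close>.\<close>
      have "C \<inter> {..x} \<subseteq> (!) ?xs ` {..<i - 1}"
      proof
        fix y assume y: "y \<in> C \<inter> {..x}"
        then obtain p where p: "p < card C" "y = ?xs ! p"
          using xs by (metis Int_iff in_set_conv_nth)
        have "p < i - 1"
          using less [of "i - 1" p] p y gt by (cases p "i - 1" rule: linorder_cases) (auto simp: entry_def)
        then show "y \<in> (!) ?xs ` {..<i - 1}" using p by blast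
      qed
      then have "card (C \<inter> {..x}) \<le> card ((!) ?xs ` {..<i - 1})"
        by (intro card_mono) auto
      also have "\<dots> \<le> i - 1"
        using card_image_le [of "{..<i - 1}" "(!) ?xs"] by simp
      finally show False using le i by simp
    qed
  qed
qed

lemma semistd2_if_card_le:
  assumes "finite E" "finite F" "card E \<le> card F" and le: "\<And>k. card (E \<inter> {..k}) \<le> card (F \<inter> {..k})"
  shows "semistd2 F E"
  unfolding semistd2_def
proof
  fix i assume i: "i \<in> {1..card E}"
  then have "i \<le> card (E \<inter> {..entry E i})"
    using entry_le_iff [of E i "entry E i"] assms(1) by simp
  then show "entry F i \<le> entry E i"
    using entry_le_iff [of F i "entry E i"] i assms(2,3) le [of "entry E i"] by simp
qed

text \<open>Row \<open>a\<close> alone decides: at least \<open>a\<close> elements of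
  \<open>F\<close> are at most \<open>a\<close>, hence they are \<open>1, ..., a\<close>.\<close>

lemma semistd2_initial:
  assumes F: "F \<subseteq> {1..n}" and a: "1 \<le> a" "a \<le> card F" and ss: "semistd2 F {1..a}"
  shows "{1..a} \<subseteq> F"
proof -
  have "entry {1..a} a \<le> a"
    using entry_le_iff [of "{1..a}" a a] a by (simp add: Int_absorb2)
  moreover have "entry F a \<le> entry {1..a} a"
    using bspec [OF ss [unfolded semistd2_def], of a] a by simp
  ultimately have "entry F a \<le> a" by simp
  then have "a \<le> card (F \<inter> {..a})"
    using entry_le_iff [of F a a] finite_subset [OF F] a by simp
  moreover have "F \<inter> {..a} \<subseteq> {1..a}" using F by auto
  ultimately have "F \<inter> {..a} = {1..a}"
    using card_mono [of "{1..a}" "F \<inter> {..a}"] by (intro card_subset_eq) auto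
  then show ?thesis by blast
qed

lemma col_le_imp_sum_le:
  assumes fin: "finite A" "finite B" and le: "col_le A B"
  shows "\<Sum>A \<le> \<Sum>B"
proof -
  have sum: "\<Sum>C = (\<Sum>i<card C. entry C (Suc i))" if "finite C" for C :: "nat set"
  proof -
    have "\<Sum>C = sum_list (sorted_list_of_set C)"
      using that sum_list_distinct_conv_sum_set [of "sorted_list_of_set C" "\<lambda>x. x"] by simp
    then show ?thesis
      using that by (simp add: sum_list_sum_nth entry_def atLeast0LessThan)
  qed
  show ?thesis
    unfolding sum [OF fin(1)] sum [OF fin(2)]
    using le by (auto simp: col_le_def intro!: sum_mono)
qed

text \<open>Comparable columns have comparable sums of entries, while \<open>scol j\<close> changes
  the sum by one when exactly one of \<open>j\<close>, \<open>Suc j\<close> is present. The order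
  hypotheses thus become membership conditions.\<close>

lemma col_le_scol:
  assumes fin: "finite C"
  shows "col_le (scol j C) C \<Longrightarrow> \<not> (j \<in> C \<and> Suc j \<notin> C)"
    and "col_le C (scol j C) \<Longrightarrow> \<not> (Suc j \<in> C \<and> j \<notin> C)"
proof -
  have fin': "finite (scol j C)" using fin by (simp add: scol_def)
  show "\<not> (j \<in> C \<and> Suc j \<notin> C)" if "col_le (scol j C) C"
    using col_le_imp_sum_le [OF fin' fin that] sum_scol_up [OF fin, of j] by auto
  show "\<not> (Suc j \<in> C \<and> j \<notin> C)" if "col_le C (scol j C)"
    using col_le_imp_sum_le [OF fin fin' that] sum_scol_up [OF fin', of j] by (auto simp: scol_mem_iff)
qed

text \<open>This is \<open>psit_scol_up\<close> read downwards: unless \<open>scol j D = D\<close>,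
  the column \<open>D\<close> is the raised form of \<open>scol j D\<close>.\<close>

lemma psit_ell_scol:
  assumes C: "C \<subseteq> {1..n}" and D: "D \<subseteq> {1..n}" and j: "j \<in> {1..<n}" and le: "col_le (scol j D) D"
  shows "psit n [C, D] = ell j (\<lambda>C. psit n [C, scol j D]) C"
proof (cases "j \<in> D \<longleftrightarrow> Suc j \<in> D")
  case True
  then show ?thesis
    using psit_scol_fixed [OF C D j] by (simp add: scol_eq)
next
  case False
  then have "Suc j \<in> D" "j \<notin> D"
    using col_le_scol(1) [OF finite_subset [OF D] le] by auto
  then show ?thesis
    using psit_scol_up [OF C scol_subset [OF D j] j] by (simp add: scol_mem_iff)
qed

lemma psit_prod:
  "tensor n Ts \<Longrightarrow> psit n Ts = (\<Prod>k<length Ts - 1. psit n [Ts ! k, Ts ! Suc k])"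
proof (induction Ts rule: induct_list012)
  case (2 C)
  then have C: "C \<subseteq> {1..n}" by (simp add: tensor_def)
  \<comment> \<open>A single column has normalised value 1, the empty product.\<close>
  have "eps n (Psi n [C]) = Wpoly n (varpi (card C))"
    unfolding Psi_Cons using eps_LU [OF ucol_in_Sn [OF C] Hpar_Hn [OF one_par_in_Hpar]]
    by (simp add: eps_one_par)
  then show ?case
    using Wpoly_neq_0 [of n "varpi (card C)"] by (simp add: psit_eq shape_def)
next
  case (3 C D S)
  then have "psit n (D # S) = (\<Prod>k<length S. psit n [(D # S) ! k, (D # S) ! Suc k])"
    by (simp add: tensor_def)
  then show ?case
    unfolding psit_Cons [OF 3(3)] by (simp add: prod.lessThan_Suc_shift del: prod.lessThan_Suc)
qed (simp add: tensor_def)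

section \<open>Integrality\<close>

definition integral :: "coef \<Rightarrow> bool" where
  "integral x \<longleftrightarrow> (\<exists>p. x = Fract p 1)"

lemma integral_const: "integral 0" "integral 1" "integral tt" "integral (1 - tt)"
proof -
  show "integral 0" "integral 1" "integral tt"
    by (auto simp: integral_def tt_def Zero_fract_def One_fract_def)
  have "1 - tt = Fract (1 - [:0, 1:]) 1"
    by (simp add: tt_def One_fract_def)
  then show "integral (1 - tt)" by (auto simp: integral_def)
qed

lemma integral_add: "integral x \<Longrightarrow> integral y \<Longrightarrow> integral (x + y)"
  by (auto simp: integral_def)

lemma integral_mult: "integral x \<Longrightarrow> integral y \<Longrightarrow> integral (x * y)"
  by (auto simp: integral_def)

lemma integral_prod: "(\<And>k. k \<in> A \<Longrightarrow> integral (f k)) \<Longrightarrow> integral (prod f A)"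
  by (induction A rule: infinite_finite_induct) (auto intro: integral_const integral_mult)

text \<open>The values at the initial column are 0 or 1, and \<open>ell j\<close> has coefficients
  in \<open>Z[t]\<close>.\<close>

lemma integral_psit_pair:
  assumes "D \<subseteq> {1..n}" "card D = a" "C \<subseteq> {1..n}" "a \<le> card C"
  shows "integral (psit n [C, D])"
  using assms
proof (induction D arbitrary: C rule: col_induct)
  case base
  show ?case
    unfolding psit_initial [OF base] by (simp add: integral_const)
next
  case (step D j)
  have "integral (psit n [C, D])" "integral (psit n [scol j C, D])"
    using step.IH [of C] step.IH [of "scol j C"] step.prems scol_subset [OF step.prems(1) step(3)] by auto
  then show ?case
    unfolding psit_scol_up [OF step.prems(1) step(1,3,4,5)] ell_def
    by (auto intro!: integral_add integral_mult integral_const)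
qed

theorem theorem7p1:
  fixes n :: nat
  assumes "1 \<le> n"
  shows "(\<forall>Ts. tensor n Ts \<longrightarrow>
            psit n Ts = (\<Prod>k<length Ts - 1. psit n [Ts ! k, Ts ! Suc k]))
    \<and> (\<forall>F E. F \<subseteq> {1..n} \<and> E \<subseteq> {1..n} \<and> 1 \<le> card E \<and> card E \<le> card F \<longrightarrow>
         (\<not> semistd2 F E \<longrightarrow> psit n [F, E] = 0)
       \<and> (E = {1..card E} \<and> semistd2 F E \<longrightarrow> psit n [F, E] = 1)
       \<and> (\<forall>j\<in>{1..n-1}. semistd2 F E \<and> col_le (scol j E) E \<longrightarrow>
            (col_le F (scol j F) \<longrightarrow>
               psit n [F, E] = tt * psit n [scol j F, scol j E] + (1 - tt) * psit n [F, scol j E])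
          \<and> (col_le (scol j F) F \<longrightarrow>
               psit n [F, E] = psit n [scol j F, scol j E])))
    \<and> (\<forall>Ts. tensor n Ts \<longrightarrow> (\<exists>p :: int poly. psit n Ts = Fract p 1))"
proof (intro conjI allI impI ballI)
  fix Ts assume "tensor n Ts"
  then show "psit n Ts = (\<Prod>k<length Ts - 1. psit n [Ts ! k, Ts ! Suc k])"
    by (rule psit_prod)
next
  fix F E :: "nat set"
  assume FE: "F \<subseteq> {1..n} \<and> E \<subseteq> {1..n} \<and> 1 \<le> card E \<and> card E \<le> card F"
  then have F: "F \<subseteq> {1..n}" "finite F" and E: "E \<subseteq> {1..n}" "finite E"
    and le: "card E \<le> card F" and pos: "1 \<le> card E"
    using finite_subset [of F "{1..n}"] finite_subset [of E "{1..n}"] by auto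
  show "psit n [F, E] = 0" if "\<not> semistd2 F E"
    using that semistd2_if_card_le [OF E(2) F(2) le] psit_support [OF E(1) refl F(1) le] by blast
  show "psit n [F, E] = 1" if "E = {1..card E} \<and> semistd2 F E"
  proof -
    have E': "{1..card E} = E" using that by blast
    then have "semistd2 F {1..card E}" using that by (simp only: E')
    then have "{1..card E} \<subseteq> F"
      by (rule semistd2_initial [OF F(1) pos le])
    then have "psit n [F, {1..card E}] = 1"
      using psit_initial [OF F(1) le] by simp
    then show ?thesis by (simp only: E')
  qed
  fix j assume j: "j \<in> {1..n - 1}" and "semistd2 F E \<and> col_le (scol j E) E"
  \<comment> \<open>Both cases of the recursion are read off from the branches of
    \<open>ell j\<close> at \<open>F\<close>.\<close>
  then have eq: "psit n [F, E] = ell j (\<lambda>C. psit n [C, scol j E]) F"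
    by (intro psit_ell_scol F E) auto
  show "psit n [F, E] = tt * psit n [scol j F, scol j E] + (1 - tt) * psit n [F, scol j E]"
    if "col_le F (scol j F)"
  proof (cases "j \<in> F \<longleftrightarrow> Suc j \<in> F")
    \<comment> \<open>When \<open>scol j F = F\<close>, both formulas of the recursion apply; they
      agree because \<open>tt * x + (1 - tt) * x = x\<close>.\<close>
    case True
    then show ?thesis
      unfolding eq scol_eq [OF True] by (simp add: ell_def left_diff_distrib)
  next
    case False
    then show ?thesis
      unfolding eq using col_le_scol(2) [OF F(2) that] by (simp add: ell_def)
  qed
  show "psit n [F, E] = psit n [scol j F, scol j E]" if "col_le (scol j F) F"
  proof (cases "j \<in> F \<longleftrightarrow> Suc j \<in> F")
    case True
    then show ?thesis
      unfolding eq scol_eq [OF True] by (simp add: ell_def)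
  next
    case False
    then show ?thesis
      unfolding eq using col_le_scol(1) [OF F(2) that] by (auto simp: ell_def)
  qed
next
  fix Ts assume T: "tensor n Ts"
  have "integral (psit n [Ts ! k, Ts ! Suc k])" if "k < length Ts - 1" for k
  proof -
    have k: "Suc k < length Ts" using that by simp
    then have "card (Ts ! Suc k) \<le> card (Ts ! k)"
      using T sorted_wrt_nth_less [of "\<lambda>C D. card D \<le> card C" Ts k "Suc k"] by (simp add: tensor_def)
    moreover have "Ts ! k \<subseteq> {1..n}" "Ts ! Suc k \<subseteq> {1..n}"
      using T k nth_mem [of k Ts] nth_mem [of "Suc k" Ts] by (auto simp: tensor_def)
    ultimately show ?thesis
      by (intro integral_psit_pair [OF _ refl])
  qed
  then have "integral (psit n Ts)"
    unfolding psit_prod [OF T] by (intro integral_prod) simp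
  then show "\<exists>p :: int poly. psit n Ts = Fract p 1"
    by (simp add: integral_def)
qed

end
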